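(* For all $n\ge1$, $$\sum_{\mu\in\mathrm{WComp}_{n-1}}\dim\mathcal{L}ie(\mu)\,\mathbf{x}^\mu=\sum_{\Upsilon\in\mathsf{Nor}_n}e_{\lambda^{\mathsf{Lyn}}(\Upsilon)}(\mathbf{x}).$$
   Context: Fix a field $\mathbf{k}$. $\mathrm{WComp}_{n-1}$: weak compositions with sum $n-1$; $\mathbf{x}^\mu=x_1^{\mu(1)}x_2^{\mu(2)}\cdots$. $\mathcal{L}ie(\mu)$ is the subspace of the multilinear component of the free Lie algebra on $[n]$ with compatible Lie brackets $[\cdot,\cdot]_j$, $j\in\mathbb{P}$ (relations: antisymmetry and Jacobi for each bracket, and $[x,[y,z]_j]_i+[z,[x,y]_j]_i+[y,[z,x]_j]_i+[x,[y,z]_i]_j+[z,[x,y]_i]_j+[y,[z,x]_i]_j=0$ for $i\ne j$) spanned by bracketed permutations with exactly $\mu(j)$ brackets of type $j$. $e_\lambda$ is the elementary symmetric function. $\mathsf{Nor}_n$: normalized labeled binary trees on $[n]$, i.e. planar rooted binary trees with leaves labeled bijectively by $[n]$ such that $v(x)=v(L(x))$ for every internal node $x$, where $L(x),R(x)$ are left/right children and the valency $v(x)$ is the smallest leaf label in the subtree rooted at $x$. An internal node $x$ is a Lyndon node if $L(x)$ is a leaf or $v(R(L(x)))>v(R(x))$. $\pi^{\mathsf{Lyn}}(\Upsilon)$ is the finest set partition of the internal nodes of $\Upsilon$ such that for each non-Lyndon internal node $x$, $x$ and $L(x)$ lie in the same block; the Lyndon type $\lambda^{\mathsf{Lyn}}(\Upsilon)$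 is the integer partition of its block sizes. *)

theory Defs
  imports "HOL-Library.Poly_Mapping" "HOL-Library.Multiset" "HOL-Library.Disjoint_Sets"
    "HOL-Computational_Algebra.Computational_Algebra"
begin

section \<open>Formal power series in countably many variables\<close>

text \<open>A power series in the variables \<open>x\<^sub>1, x\<^sub>2, \<dots>\<close> is its family of coefficients, indexed by
  the exponent vectors \<open>\<mu> :: nat \<Rightarrow>\<^sub>0 nat\<close>.  Throughout, the index set of the
  positive integers (variables as well as bracket types) is encoded by \<^typ>\<open>nat\<close>, the index \<open>j\<close>
  of type \<^typ>\<open>nat\<close> standing for the positive integer \<open>j + 1\<close>.\<close>

typedef 'a mvps = "UNIV :: ((nat \<Rightarrow>\<^sub>0 nat) \<Rightarrow> 'a) set"
  morphisms mvps_coeff Abs_mvps by simp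

setup_lifting type_definition_mvps

lemma mvps_eqI: "(\<And>m. mvps_coeff f m = mvps_coeff g m) \<Longrightarrow> f = g"
  by (metis ext mvps_coeff_inject)

lemma mvps_coeff_Abs [simp]: "mvps_coeff (Abs_mvps f) = f"
  by (simp add: Abs_mvps_inverse)

definition splits :: "(nat \<Rightarrow>\<^sub>0 nat) \<Rightarrow> ((nat \<Rightarrow>\<^sub>0 nat) \<times> (nat \<Rightarrow>\<^sub>0 nat)) set" where
  "splits m = {(a, b). a + b = m}"

lemma finite_splits [simp]: "finite (splits m)"
proof -
  let ?S = "{f. \<forall>x. (x \<in> Poly_Mapping.keys m \<longrightarrow> f x \<in> {..Max (Poly_Mapping.lookup m ` Poly_Mapping.keys m)}) \<and> (x \<notin> Poly_Mapping.keys m \<longrightarrow> f x = (0::nat))}"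
  have fin: "finite ?S"
    by (rule finite_set_of_finite_funs) auto
  have in_S: "Poly_Mapping.lookup a \<in> ?S" if "a + b = m" for a b
  proof -
    have le: "Poly_Mapping.lookup a x \<le> Poly_Mapping.lookup m x" for x
      using that by (auto simp: lookup_add)
    have "Poly_Mapping.lookup a x \<in> {..Max (Poly_Mapping.lookup m ` Poly_Mapping.keys m)}"
      if "x \<in> Poly_Mapping.keys m" for x
      using order_trans[OF le Max_ge] that by simp
    moreover have "Poly_Mapping.lookup a x = 0" if "x \<notin> Poly_Mapping.keys m" for x
      using le[of x] that by (simp add: in_keys_iff)
    ultimately show ?thesis by simp
  qed
  have "(\<lambda>(a, b). (Poly_Mapping.lookup a, Poly_Mapping.lookup b)) ` splits m \<subseteq> ?S \<times> ?S"
    using in_S by (fastforce simp: splits_def add.commute)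
  moreover have "inj_on (\<lambda>(a, b). (Poly_Mapping.lookup a, Poly_Mapping.lookup b)) (splits m)"
    by (auto intro!: inj_onI)
  ultimately show ?thesis
    using fin by (meson finite_SigmaI finite_imageD finite_subset)
qed

instantiation mvps :: (comm_semiring_1) comm_semiring_1
begin

definition zero_mvps :: "'a mvps" where "zero_mvps = Abs_mvps (\<lambda>_. 0)"
definition one_mvps :: "'a mvps" where "one_mvps = Abs_mvps (\<lambda>m. if m = 0 then 1 else 0)"
definition plus_mvps :: "'a mvps \<Rightarrow> 'a mvps \<Rightarrow> 'a mvps" where
  "plus_mvps f g = Abs_mvps (\<lambda>m. mvps_coeff f m + mvps_coeff g m)"
definition times_mvps :: "'a mvps \<Rightarrow> 'a mvps \<Rightarrow> 'a mvps" where
  "times_mvps f g = Abs_mvps (\<lambda>m. \<Sum>(a, b)\<in>splits m. mvps_coeff f a * mvps_coeff g b)"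

instance
proof
  fix f g h :: "'a mvps"
  show "f + g + h = f + (g + h)" "f + g = g + f" "0 + f = f"
    by (auto intro!: mvps_eqI simp: plus_mvps_def zero_mvps_def algebra_simps)
  show "0 * f = 0" "f * 0 = 0"
    by (auto intro!: mvps_eqI simp: times_mvps_def zero_mvps_def)
  show "(f + g) * h = f * h + g * h"
    by (auto intro!: mvps_eqI simp: plus_mvps_def times_mvps_def algebra_simps sum.distrib case_prod_unfold)
  show "(0 :: 'a mvps) \<noteq> 1"
  proof
    assume "(0 :: 'a mvps) = 1"
    then have "mvps_coeff (0 :: 'a mvps) 0 = mvps_coeff 1 0" by simp
    then show False by (simp add: zero_mvps_def one_mvps_def)
  qed
  show "f * g = g * f"
    by (auto intro!: mvps_eqI sum.reindex_bij_witness[where i = prod.swap and j = prod.swap]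
        simp: times_mvps_def splits_def algebra_simps)
  show "1 * f = f"
  proof (rule mvps_eqI)
    fix m
    have "mvps_coeff (1 * f) m = (\<Sum>(a, b)\<in>splits m. if (a, b) = (0, m) then mvps_coeff f m else 0)"
      by (auto intro!: sum.cong simp: times_mvps_def one_mvps_def splits_def)
    also have "\<dots> = (\<Sum>p\<in>splits m. if p = (0, m) then mvps_coeff f m else 0)"
      by (rule sum.cong) (simp_all add: case_prod_unfold prod_eq_iff)
    also have "\<dots> = mvps_coeff f m"
      using sum.delta[OF finite_splits[of m], of "(0, m)" "\<lambda>_. mvps_coeff f m"]
      by (simp add: splits_def)
    finally show "mvps_coeff (1 * f) m = mvps_coeff f m" .
  qed
  show "f * g * h = f * (g * h)"
  proof (rule mvps_eqI)
    fix m
    let ?F = "mvps_coeff f" and ?G = "mvps_coeff g" and ?H = "mvps_coeff h"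
    have "mvps_coeff (f * g * h) m =
        (\<Sum>p\<in>splits m. \<Sum>q\<in>splits (fst p). ?F (fst q) * ?G (snd q) * ?H (snd p))"
      by (simp add: times_mvps_def case_prod_unfold sum_distrib_right)
    also have "\<dots> = (\<Sum>(p, q)\<in>(SIGMA p:splits m. splits (fst p)). ?F (fst q) * ?G (snd q) * ?H (snd p))"
      by (subst sum.Sigma) auto
    also have "\<dots> = (\<Sum>(p, q)\<in>(SIGMA p:splits m. splits (snd p)). ?F (fst p) * (?G (fst q) * ?H (snd q)))"
      by (rule sum.reindex_bij_witness
          [where j = "\<lambda>(p, q). ((fst q, snd q + snd p), (snd q, snd p))"
             and i = "\<lambda>(p, q). ((fst p + fst q, snd q), (fst p, fst q))"])
        (auto simp: splits_def algebra_simps)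
    also have "\<dots> = (\<Sum>p\<in>splits m. \<Sum>q\<in>splits (snd p). ?F (fst p) * (?G (fst q) * ?H (snd q)))"
      by (subst sum.Sigma) auto
    also have "\<dots> = mvps_coeff (f * (g * h)) m"
      by (simp add: times_mvps_def case_prod_unfold sum_distrib_left)
    finally show "mvps_coeff (f * g * h) m = mvps_coeff (f * (g * h)) m" .
  qed
qed

end

text \<open>The (possibly infinite) formal sum of the terms \<open>c \<mu> * x^\<mu>\<close> over \<open>\<mu> \<in> A\<close>.\<close>

definition formal_sum :: "(nat \<Rightarrow>\<^sub>0 nat) set \<Rightarrow> ((nat \<Rightarrow>\<^sub>0 nat) \<Rightarrow> 'a) \<Rightarrow> 'a::zero mvps" where
  "formal_sum A c = Abs_mvps (\<lambda>\<mu>. if \<mu> \<in> A then c \<mu> else 0)"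

definition WComp :: "nat \<Rightarrow> (nat \<Rightarrow>\<^sub>0 nat) set" where
  "WComp m = {\<mu>. (\<Sum>j\<in>Poly_Mapping.keys \<mu>. Poly_Mapping.lookup \<mu> j) = m}"

text \<open>The squarefree monomials of degree \<open>k\<close> are the products of \<open>k\<close> distinct variables.\<close>

definition elem_sym :: "nat \<Rightarrow> int mvps" where
  "elem_sym k = formal_sum {\<mu> \<in> WComp k. \<forall>j. Poly_Mapping.lookup \<mu> j \<le> 1} (\<lambda>_. 1)"

text \<open>Integer partitions are multisets of their parts.\<close>

definition elem_sym_partition :: "nat multiset \<Rightarrow> int mvps" where
  "elem_sym_partition parts = prod_mset (image_mset elem_sym parts)"


section \<open>The free Lie algebra with compatible brackets\<close>

text \<open>Bracketed words: \<open>Br j s t\<close> is the formal bracket of type \<open>j\<close> of \<open>s\<close> and \<open>t\<close>.  The free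
  nonassociative algebra with one binary product for each bracket type consists of the finitely
  supported functions from bracketed words to the field.\<close>

datatype 'a bword = Gen 'a | Br nat "'a bword" "'a bword"

type_synonym ('a, 'k) free_magma_alg = "'a bword \<Rightarrow>\<^sub>0 'k"

definition smul :: "'k::field \<Rightarrow> ('a, 'k) free_magma_alg \<Rightarrow> ('a, 'k) free_magma_alg" where
  "smul c p = Poly_Mapping.map ((*) c) p"

definition fbr :: "nat \<Rightarrow> ('a, 'k::field) free_magma_alg \<Rightarrow> ('a, 'k) free_magma_alg
    \<Rightarrow> ('a, 'k) free_magma_alg" where
  "fbr j p q = (\<Sum>s\<in>Poly_Mapping.keys p. \<Sum>t\<in>Poly_Mapping.keys q. Poly_Mapping.single (Br j s t) (Poly_Mapping.lookup p s * Poly_Mapping.lookup q t))"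

text \<open>The subalgebra generated by \<open>X\<close>, i.e. the free nonassociative algebra on \<open>X\<close>.\<close>

definition free_magma_on :: "'a set \<Rightarrow> ('a, 'k::field) free_magma_alg set" where
  "free_magma_on X = {p. \<forall>t\<in>Poly_Mapping.keys p. set_bword t \<subseteq> X}"

text \<open>The two-sided ideal of the free nonassociative algebra on \<open>X\<close> generated by the relations.\<close>

inductive_set compat_ideal :: "'a set \<Rightarrow> ('a, 'k::field) free_magma_alg set" for X :: "'a set" where
  zero: "0 \<in> compat_ideal X"
| add: "p \<in> compat_ideal X \<Longrightarrow> q \<in> compat_ideal X \<Longrightarrow> p + q \<in> compat_ideal X"
| smul: "p \<in> compat_ideal X \<Longrightarrow> smul c p \<in> compat_ideal X"
| left: "p \<in> compat_ideal X \<Longrightarrow> x \<in> free_magma_on X \<Longrightarrow> fbr j x p \<in> compat_ideal X"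
| right: "p \<in> compat_ideal X \<Longrightarrow> x \<in> free_magma_on X \<Longrightarrow> fbr j p x \<in> compat_ideal X"
| antisym: "\<lbrakk>x \<in> free_magma_on X; y \<in> free_magma_on X\<rbrakk> \<Longrightarrow> fbr j x y + fbr j y x \<in> compat_ideal X"
| jacobi: "\<lbrakk>x \<in> free_magma_on X; y \<in> free_magma_on X; z \<in> free_magma_on X\<rbrakk> \<Longrightarrow>
    fbr j x (fbr j y z) + fbr j z (fbr j x y) + fbr j y (fbr j z x) \<in> compat_ideal X"
| compat: "\<lbrakk>x \<in> free_magma_on X; y \<in> free_magma_on X; z \<in> free_magma_on X; i \<noteq> j\<rbrakk> \<Longrightarrow>
    fbr i x (fbr j y z) + fbr i z (fbr j x y) + fbr i y (fbr j z x) +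
    fbr j x (fbr i y z) + fbr j z (fbr i x y) + fbr j y (fbr i z x) \<in> compat_ideal X"

lemma lookup_smul [simp]: "Poly_Mapping.lookup (smul c p) t = c * Poly_Mapping.lookup p t"
  by (simp add: smul_def map.rep_eq when_def)

lemma smul_minus_one: "smul (- 1) p = - p"
  by (rule poly_mapping_eqI) simp

lemma smul_module:
  "smul a (p + q) = smul a p + smul a q" "smul (a + b) p = smul a p + smul b p"
  "smul a (smul b p) = smul (a * b) p" "smul 1 p = p" "smul a (p - q) = smul a p - smul a q"
  by (rule poly_mapping_eqI; simp add: lookup_add lookup_minus algebra_simps)+

lemma fbr_superset:
  assumes "finite A" "finite B" "Poly_Mapping.keys p \<subseteq> A" "Poly_Mapping.keys q \<subseteq> B"
  shows "fbr j p q = (\<Sum>s\<in>A. \<Sum>t\<in>B. Poly_Mapping.single (Br j s t) (Poly_Mapping.lookup p s * Poly_Mapping.lookup q t))"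
proof -
  have "(\<Sum>s\<in>A. \<Sum>t\<in>B. Poly_Mapping.single (Br j s t) (Poly_Mapping.lookup p s * Poly_Mapping.lookup q t)) =
      (\<Sum>s\<in>Poly_Mapping.keys p. \<Sum>t\<in>B. Poly_Mapping.single (Br j s t) (Poly_Mapping.lookup p s * Poly_Mapping.lookup q t))"
    using assms by (intro sum.mono_neutral_right) (auto simp: in_keys_iff)
  also have "\<dots> = fbr j p q"
    unfolding fbr_def using assms
    by (intro sum.cong sum.mono_neutral_right refl) (auto simp: in_keys_iff)
  finally show ?thesis by simp
qed

lemma fbr_add_left: "fbr j (p + p') q = fbr j p q + fbr j p' q"
proof -
  let ?A = "Poly_Mapping.keys p \<union> Poly_Mapping.keys p'"
  have "Poly_Mapping.keys (p + p') \<subseteq> ?A" by (rule keys_add)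
  then show ?thesis
    by (simp add: fbr_superset[where A = ?A and B = "Poly_Mapping.keys q"] lookup_add algebra_simps
        single_add sum.distrib)
qed

lemma fbr_add_right: "fbr j p (q + q') = fbr j p q + fbr j p q'"
proof -
  let ?A = "Poly_Mapping.keys q \<union> Poly_Mapping.keys q'"
  have "Poly_Mapping.keys (q + q') \<subseteq> ?A" by (rule keys_add)
  then show ?thesis
    by (simp add: fbr_superset[where B = ?A and A = "Poly_Mapping.keys p"] lookup_add algebra_simps
        single_add sum.distrib)
qed

lemma smul_sum: "smul c (sum f A) = (\<Sum>a\<in>A. smul c (f a))"
  by (induction A rule: infinite_finite_induct) (auto simp: smul_module(1) intro!: poly_mapping_eqI)

lemma smul_single: "smul c (Poly_Mapping.single t d) = Poly_Mapping.single t (c * d)"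
  by (rule poly_mapping_eqI) (simp add: lookup_single when_def)

lemma fbr_smul_left: "fbr j (smul c p) q = smul c (fbr j p q)"
proof -
  have "Poly_Mapping.keys (smul c p) \<subseteq> Poly_Mapping.keys p" by (auto simp: in_keys_iff)
  then show ?thesis
    by (simp add: fbr_superset[where A = "Poly_Mapping.keys p" and B = "Poly_Mapping.keys q"] smul_sum smul_single
        algebra_simps)
qed

lemma fbr_smul_right: "fbr j p (smul c q) = smul c (fbr j p q)"
proof -
  have "Poly_Mapping.keys (smul c q) \<subseteq> Poly_Mapping.keys q" by (auto simp: in_keys_iff)
  then show ?thesis
    by (simp add: fbr_superset[where A = "Poly_Mapping.keys p" and B = "Poly_Mapping.keys q"] smul_sum smul_single
        algebra_simps)
qed

lemma fbr_single: "fbr j (Poly_Mapping.single s c) (Poly_Mapping.single t d) =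
    Poly_Mapping.single (Br j s t) (c * d)"
  by (subst fbr_superset[where A = "{s}" and B = "{t}"]) auto

lemma fbr_diff_left: "fbr j (p - p') q = fbr j p q - fbr j p' q"
  using fbr_add_left[of j "p - p'" p' q] by simp

lemma fbr_diff_right: "fbr j p (q - q') = fbr j p q - fbr j p q'"
  using fbr_add_right[of j p "q - q'" q'] by simp

lemma compat_ideal_uminus: "p \<in> compat_ideal X \<Longrightarrow> - p \<in> compat_ideal X"
  by (metis compat_ideal.smul smul_minus_one)

lemma compat_ideal_diff: "p \<in> compat_ideal X \<Longrightarrow> q \<in> compat_ideal X \<Longrightarrow> p - q \<in> compat_ideal X"
  by (metis compat_ideal.add compat_ideal_uminus diff_conv_add_uminus)

lemma free_magma_on_UNIV [simp]: "p \<in> free_magma_on UNIV"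
  by (simp add: free_magma_on_def)

lemma compat_ideal_uminus_iff: "- p \<in> compat_ideal X \<longleftrightarrow> p \<in> compat_ideal X"
  by (metis compat_ideal_uminus minus_minus)

text \<open>The free Lie algebra with compatible brackets on the set of all elements of the type \<open>'a\<close>.\<close>

quotient_type (overloaded) ('a, 'k) free_lie = "('a, 'k::field) free_magma_alg" /
  "\<lambda>p q. p - q \<in> compat_ideal UNIV"
  morphisms rep_free_lie lie_class
proof (rule equivpI)
  show "reflp (\<lambda>p q :: ('a, 'k) free_magma_alg. p - q \<in> compat_ideal UNIV)"
    by (simp add: reflp_def compat_ideal.zero)
  show "symp (\<lambda>p q :: ('a, 'k) free_magma_alg. p - q \<in> compat_ideal UNIV)"
  proof (rule sympI)
    fix p q :: "('a, 'k) free_magma_alg"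
    assume "p - q \<in> compat_ideal UNIV"
    from compat_ideal_uminus[OF this] show "q - p \<in> compat_ideal UNIV" by simp
  qed
  show "transp (\<lambda>p q :: ('a, 'k) free_magma_alg. p - q \<in> compat_ideal UNIV)"
  proof (rule transpI)
    fix p q r :: "('a, 'k) free_magma_alg"
    assume "p - q \<in> compat_ideal UNIV" "q - r \<in> compat_ideal UNIV"
    from compat_ideal.add[OF this] show "p - r \<in> compat_ideal UNIV" by simp
  qed
qed

instantiation free_lie :: (type, field) ab_group_add
begin

lift_definition zero_free_lie :: "('a, 'b) free_lie" is 0 .
lift_definition plus_free_lie :: "('a, 'b) free_lie \<Rightarrow> ('a, 'b) free_lie \<Rightarrow> ('a, 'b) free_lie" is "(+)"
  by (simp add: add_diff_add compat_ideal.add)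
lift_definition uminus_free_lie :: "('a, 'b) free_lie \<Rightarrow> ('a, 'b) free_lie" is uminus
  by (drule compat_ideal_uminus) (simp add: minus_diff_minus)
lift_definition minus_free_lie :: "('a, 'b) free_lie \<Rightarrow> ('a, 'b) free_lie \<Rightarrow> ('a, 'b) free_lie" is "(-)"
proof -
  fix p p' q q' :: "('a, 'b) free_magma_alg"
  assume "p - p' \<in> compat_ideal UNIV" "q - q' \<in> compat_ideal UNIV"
  then have "(p - p') - (q - q') \<in> compat_ideal UNIV" by (rule compat_ideal_diff)
  then show "p - q - (p' - q') \<in> compat_ideal UNIV" by (simp add: algebra_simps)
qed

instance
  by standard (transfer; simp add: algebra_simps compat_ideal.zero)+

end

lift_definition lie_scale :: "'k::field \<Rightarrow> ('a, 'k) free_lie \<Rightarrow> ('a, 'k) free_lie" is smul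
  by (simp add: compat_ideal.smul flip: smul_module(5))

lift_definition lie_bracket :: "nat \<Rightarrow> ('a, 'k::field) free_lie \<Rightarrow> ('a, 'k) free_lie \<Rightarrow> ('a, 'k) free_lie"
  is fbr
proof -
  fix j and p p' q q' :: "('a, 'k) free_magma_alg"
  assume "p - p' \<in> compat_ideal UNIV" "q - q' \<in> compat_ideal UNIV"
  then have "fbr j (p - p') q + fbr j p' (q - q') \<in> compat_ideal UNIV"
    by (intro compat_ideal.intros) auto
  then show "fbr j p q - fbr j p' q' \<in> compat_ideal UNIV"
    by (simp add: fbr_diff_left fbr_diff_right)
qed

lift_definition lie_gen :: "'a \<Rightarrow> ('a, 'k::field) free_lie" is "\<lambda>a. Poly_Mapping.single (Gen a) 1" .

interpretation free_lie: vector_space "lie_scale :: 'k::field \<Rightarrow> ('a, 'k) free_lie \<Rightarrow> ('a, 'k) free_lie"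
  by standard (transfer; simp add: smul_module compat_ideal.zero)+

lemma lie_bracket_linear:
  "lie_bracket j (x + y) z = lie_bracket j x z + lie_bracket j y z"
  "lie_bracket j x (y + z) = lie_bracket j x y + lie_bracket j x z"
  "lie_bracket j (lie_scale c x) y = lie_scale c (lie_bracket j x y)"
  "lie_bracket j x (lie_scale c y) = lie_scale c (lie_bracket j x y)"
  by (transfer; simp add: fbr_add_left fbr_add_right fbr_smul_left fbr_smul_right compat_ideal.zero)+

lemma lie_bracket_antisym: "lie_bracket j x y + lie_bracket j y x = 0"
  by transfer (simp add: compat_ideal.antisym)

lemma lie_bracket_jacobi:
  "lie_bracket j x (lie_bracket j y z) + lie_bracket j z (lie_bracket j x y) +
    lie_bracket j y (lie_bracket j z x) = 0"
  by transfer (simp add: compat_ideal.jacobi)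

lemma lie_bracket_compat:
  "i \<noteq> j \<Longrightarrow>
    lie_bracket i x (lie_bracket j y z) + lie_bracket i z (lie_bracket j x y) +
    lie_bracket i y (lie_bracket j z x) + lie_bracket j x (lie_bracket i y z) +
    lie_bracket j z (lie_bracket i x y) + lie_bracket j y (lie_bracket i z x) = 0"
  by transfer (simp add: compat_ideal.compat)

text \<open>The subalgebra of \<^typ>\<open>('a, 'k::field) free_lie\<close> generated by a nonempty set \<open>X\<close> is the free Lie
  algebra with compatible brackets on \<open>X\<close>: the relations of the former between elements
  of the free nonassociative algebra on \<open>X\<close> are the ones that already follow from the relations
  on \<open>X\<close>, see \<open>free_lie_on\<close>.  So the free Lie algebra on \<open>{1..n}\<close> is found inside the free Lie algebra on \<^typ>\<open>nat\<close>.\<close>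

definition relabel :: "('a \<Rightarrow> 'b) \<Rightarrow> ('a, 'k::field) free_magma_alg \<Rightarrow> ('b, 'k) free_magma_alg" where
  "relabel r p = (\<Sum>t\<in>Poly_Mapping.keys p. Poly_Mapping.single (map_bword r t) (Poly_Mapping.lookup p t))"

lemma relabel_superset:
  "finite A \<Longrightarrow> Poly_Mapping.keys p \<subseteq> A \<Longrightarrow>
    relabel r p = (\<Sum>t\<in>A. Poly_Mapping.single (map_bword r t) (Poly_Mapping.lookup p t))"
  unfolding relabel_def by (intro sum.mono_neutral_left) (auto simp: in_keys_iff)

lemma relabel_add: "relabel r (p + q) = relabel r p + relabel r q"
proof -
  let ?A = "Poly_Mapping.keys p \<union> Poly_Mapping.keys q"
  have "Poly_Mapping.keys (p + q) \<subseteq> ?A" by (rule keys_add)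
  then show ?thesis
    by (simp add: relabel_superset[where A = ?A] lookup_add single_add sum.distrib)
qed

lemma relabel_smul: "relabel r (smul c p) = smul c (relabel r p)"
proof -
  have "Poly_Mapping.keys (smul c p) \<subseteq> Poly_Mapping.keys p" by (auto simp: in_keys_iff)
  then show ?thesis
    by (simp add: relabel_superset[where A = "Poly_Mapping.keys p"] smul_sum smul_single)
qed

lemma relabel_0 [simp]: "relabel r 0 = 0"
  by (simp add: relabel_def)

lemma relabel_single: "relabel r (Poly_Mapping.single t c) = Poly_Mapping.single (map_bword r t) c"
  by (subst relabel_superset[where A = "{t}"]) auto

lemma relabel_sum: "relabel r (sum f A) = (\<Sum>a\<in>A. relabel r (f a))"
  by (induction A rule: infinite_finite_induct) (auto simp: relabel_add)

lemma fbr_0 [simp]: "fbr j 0 q = 0" "fbr j p 0 = 0"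
  by (simp_all add: fbr_def)

lemma fbr_sum_left: "fbr j (sum f A) q = (\<Sum>a\<in>A. fbr j (f a) q)"
  by (induction A rule: infinite_finite_induct) (auto simp: fbr_add_left)

lemma fbr_sum_right: "fbr j p (sum f A) = (\<Sum>a\<in>A. fbr j p (f a))"
  by (induction A rule: infinite_finite_induct) (auto simp: fbr_add_right)

lemma relabel_fbr: "relabel r (fbr j p q) = fbr j (relabel r p) (relabel r q)"
proof -
  have "relabel r (fbr j p q) =
      (\<Sum>s\<in>Poly_Mapping.keys p. \<Sum>t\<in>Poly_Mapping.keys q. Poly_Mapping.single (Br j (map_bword r s) (map_bword r t)) (Poly_Mapping.lookup p s * Poly_Mapping.lookup q t))"
    by (simp add: fbr_def relabel_sum relabel_single)
  also have "\<dots> = fbr j (relabel r p) (relabel r q)"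
    unfolding relabel_def fbr_sum_left fbr_sum_right fbr_single by (rule sum.swap)
  finally show ?thesis .
qed

lemma relabel_in: "range r \<subseteq> X \<Longrightarrow> relabel r p \<in> free_magma_on X"
proof -
  assume r: "range r \<subseteq> X"
  have "Poly_Mapping.keys (relabel r p) \<subseteq> (\<Union>t\<in>Poly_Mapping.keys p. Poly_Mapping.keys (Poly_Mapping.single (map_bword r t) (Poly_Mapping.lookup p t)))"
    unfolding relabel_def by (rule keys_sum)
  then show ?thesis
    using r by (fastforce simp: free_magma_on_def bword.set_map split: if_splits)
qed

lemma poly_mapping_sum_single: "(\<Sum>t\<in>Poly_Mapping.keys p. Poly_Mapping.single t (Poly_Mapping.lookup p t)) = p"
  by (rule poly_mapping_eqI) (simp add: lookup_sum lookup_single when_def in_keys_iff)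

lemma relabel_id: "(\<And>x. x \<in> X \<Longrightarrow> r x = x) \<Longrightarrow> p \<in> free_magma_on X \<Longrightarrow> relabel r p = p"
proof -
  assume r: "\<And>x. x \<in> X \<Longrightarrow> r x = x" and p: "p \<in> free_magma_on X"
  have "map_bword r t = t" if "t \<in> Poly_Mapping.keys p" for t
    using that r p by (intro bword.map_ident_strong) (auto simp: free_magma_on_def)
  then show ?thesis
    by (simp add: relabel_def poly_mapping_sum_single)
qed

lemma relabel_compat_ideal:
  assumes r: "range r \<subseteq> X" and "p \<in> compat_ideal UNIV"
  shows "relabel r p \<in> compat_ideal X"
  using assms(2)
  by induction
    (simp_all add: relabel_add relabel_smul relabel_fbr compat_ideal.intros relabel_in[OF r])

lemma compat_ideal_mono:
  assumes "X \<subseteq> Y" "p \<in> compat_ideal X"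
  shows "p \<in> compat_ideal Y"
proof -
  have *: "x \<in> free_magma_on Y" if "x \<in> free_magma_on X" for x :: "('a, 'b) free_magma_alg"
    using that assms(1) by (auto simp: free_magma_on_def)
  show ?thesis
    using assms(2) by induction (auto intro: compat_ideal.intros *)
qed

lemma free_lie_on:
  assumes "X \<noteq> {}" "p \<in> free_magma_on X" "q \<in> free_magma_on X"
  shows "lie_class p = lie_class q \<longleftrightarrow> p - q \<in> compat_ideal X"
proof -
  have "p - q \<in> free_magma_on X"
    using assms(2,3) keys_diff[of p q] by (force simp: free_magma_on_def)
  moreover obtain a where "a \<in> X" using assms(1) by blast
  ultimately have "p - q \<in> compat_ideal X" if "p - q \<in> compat_ideal UNIV"
    using relabel_compat_ideal[OF _ that, of "\<lambda>x. if x \<in> X then x else a" X]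
      relabel_id[of X "\<lambda>x. if x \<in> X then x else a" "p - q"] by auto
  then show ?thesis
    using compat_ideal_mono[of X UNIV "p - q"] by (auto simp: free_lie.abs_eq_iff)
qed

primrec leaves_bword :: "'a bword \<Rightarrow> 'a list" where
  "leaves_bword (Gen a) = [a]"
| "leaves_bword (Br j s t) = leaves_bword s @ leaves_bword t"

primrec bracket_count :: "nat \<Rightarrow> 'a bword \<Rightarrow> nat" where
  "bracket_count j (Gen a) = 0"
| "bracket_count j (Br i s t) = (if i = j then 1 else 0) + bracket_count j s + bracket_count j t"

definition bracketed_perms :: "nat \<Rightarrow> nat bword set" where
  "bracketed_perms n = {t. distinct (leaves_bword t) \<and> set (leaves_bword t) = {1..n}}"

primrec lie_eval :: "'a bword \<Rightarrow> ('a, 'k::field) free_lie" where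
  "lie_eval (Gen a) = lie_gen a"
| "lie_eval (Br j s t) = lie_bracket j (lie_eval s) (lie_eval t)"

text \<open>\<open>Lie n \<mu>\<close> is \<open>\<L>ie(\<mu>)\<close> for \<open>\<mu> \<in> WComp (n - 1)\<close>.\<close>

definition Lie :: "nat \<Rightarrow> (nat \<Rightarrow>\<^sub>0 nat) \<Rightarrow> (nat, 'k::field) free_lie set" where
  "Lie n \<mu> = free_lie.span
    (lie_eval ` {t \<in> bracketed_perms n. \<forall>j. bracket_count j t = Poly_Mapping.lookup \<mu> j})"


section \<open>Normalized trees and Lyndon types\<close>

datatype ltree = Leaf nat | Node ltree ltree

primrec leaves :: "ltree \<Rightarrow> nat list" where
  "leaves (Leaf a) = [a]"
| "leaves (Node l r) = leaves l @ leaves r"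

definition valency :: "ltree \<Rightarrow> nat" where
  "valency t = Min (set (leaves t))"

text \<open>The leaf labels of the trees considered are distinct, so a node is identified with the subtree
  rooted at it.\<close>

primrec internal_nodes :: "ltree \<Rightarrow> ltree set" where
  "internal_nodes (Leaf a) = {}"
| "internal_nodes (Node l r) = insert (Node l r) (internal_nodes l \<union> internal_nodes r)"

fun left_child :: "ltree \<Rightarrow> ltree" where
  "left_child (Node l r) = l"
| "left_child (Leaf a) = Leaf a"

fun is_lyndon :: "ltree \<Rightarrow> bool" where
  "is_lyndon (Node (Leaf a) r) = True"
| "is_lyndon (Node (Node a b) r) = (valency b > valency r)"
| "is_lyndon (Leaf a) = False"

definition Nor :: "nat \<Rightarrow> ltree set" where
  "Nor n = {t. distinct (leaves t) \<and> set (leaves t) = {1..n} \<and>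
     (\<forall>x\<in>internal_nodes t. valency x = valency (left_child x))}"

definition lyndon_compatible :: "ltree \<Rightarrow> ltree set set \<Rightarrow> bool" where
  "lyndon_compatible t P \<longleftrightarrow> partition_on (internal_nodes t) P \<and>
     (\<forall>x\<in>internal_nodes t. \<not> is_lyndon x \<longrightarrow> (\<exists>B\<in>P. x \<in> B \<and> left_child x \<in> B))"

definition lyndon_partition :: "ltree \<Rightarrow> ltree set set" where
  "lyndon_partition t = (THE P. lyndon_compatible t P \<and>
     (\<forall>Q. lyndon_compatible t Q \<longrightarrow> refines (internal_nodes t) P Q))"

definition lyndon_type :: "ltree \<Rightarrow> nat multiset" where
  "lyndon_type t = image_mset card (mset_set (lyndon_partition t))"

lemma left_child_internal:
  "x \<in> internal_nodes t \<Longrightarrow> \<not> is_lyndon x \<Longrightarrow> left_child x \<in> internal_nodes t"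
proof (induction t)
  case (Node l r)
  have "l \<in> internal_nodes l" if "\<not> is_lyndon (Node l r)"
    using that by (cases l) auto
  with Node show ?case by auto
qed auto

lemma lyndon_partition_exists_unique:
  "\<exists>!P. lyndon_compatible t P \<and> (\<forall>Q. lyndon_compatible t Q \<longrightarrow> refines (internal_nodes t) P Q)"
proof (rule ex_ex1I)
  let ?A = "internal_nodes t" and ?F = "{Q. lyndon_compatible t Q}"
  let ?P = "common_refinement ?F"
  have part: "partition_on ?A Q" if "Q \<in> ?F" for Q
    using that by (simp add: lyndon_compatible_def)
  have "lyndon_compatible t ({?A} - {{}})"
    unfolding lyndon_compatible_def
  proof (intro conjI ballI impI)
    show "partition_on ?A ({?A} - {{}})"
      by (cases "?A = {}") (simp_all add: partition_on_empty partition_on_space)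
    show "\<exists>B\<in>{?A} - {{}}. x \<in> B \<and> left_child x \<in> B"
      if "x \<in> ?A" "\<not> is_lyndon x" for x
      using that left_child_internal[OF that] by blast
  qed
  then have ne: "?F \<noteq> {}" by blast
  have "\<exists>B\<in>?P. x \<in> B \<and> left_child x \<in> B" if "x \<in> ?A" "\<not> is_lyndon x" for x
  proof -
    have "\<forall>Q\<in>?F. \<exists>B\<in>Q. x \<in> B \<and> left_child x \<in> B"
      using that by (auto simp: lyndon_compatible_def)
    then obtain f where f: "\<forall>Q\<in>?F. f Q \<in> Q \<and> x \<in> f Q \<and> left_child x \<in> f Q"
      by metis
    then have "\<Inter> (f ` ?F) \<in> ?P"
      unfolding common_refinement by (intro DiffI UN_I[of f]) auto
    with f show ?thesis by (intro bexI[of _ "\<Inter> (f ` ?F)"]) auto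
  qed
  then have "lyndon_compatible t ?P"
    using partition_on_common_refinement[OF part ne] by (simp add: lyndon_compatible_def)
  moreover have "refines ?A ?P Q" if "lyndon_compatible t Q" for Q
    using refines_common_refinement[OF part] that by blast
  ultimately show "\<exists>P. lyndon_compatible t P \<and> (\<forall>Q. lyndon_compatible t Q \<longrightarrow> refines ?A P Q)"
    by blast
next
  fix P Q
  assume "lyndon_compatible t P \<and> (\<forall>R. lyndon_compatible t R \<longrightarrow> refines (internal_nodes t) P R)"
    and "lyndon_compatible t Q \<and> (\<forall>R. lyndon_compatible t R \<longrightarrow> refines (internal_nodes t) Q R)"
  then have "refines (internal_nodes t) P Q" "refines (internal_nodes t) Q P"
    by blast+
  then show "P = Q"
    by (rule refines_asym)
qed

lemma finite_Nor: "finite (Nor n)"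
proof -
  define T where "T m = {t. set (leaves t) \<subseteq> {1..n} \<and> length (leaves t) \<le> m}" for m
  have fin: "finite (T m)" for m
  proof (induction m)
    case 0
    have "leaves t \<noteq> []" for t by (induction t) auto
    then show ?case by (simp add: T_def)
  next
    case (Suc m)
    have "t \<in> Leaf ` {1..n} \<union> (\<lambda>(l, r). Node l r) ` (T m \<times> T m)" if "t \<in> T (Suc m)" for t
    proof (cases t)
      case (Leaf a)
      with that show ?thesis by (auto simp: T_def)
    next
      case (Node l r)
      have "leaves s \<noteq> []" for s by (induction s) auto
      then have "length (leaves l) > 0" "length (leaves r) > 0" by auto
      then have "(l, r) \<in> T m \<times> T m"
        using that unfolding Node by (simp flip: length_greater_0_conv add: T_def)
      then show ?thesis unfolding Node by (intro UnI2 image_eqI[of _ _ "(l, r)"]) simp_all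
    qed
    then have "T (Suc m) \<subseteq> Leaf ` {1..n} \<union> (\<lambda>(l, r). Node l r) ` (T m \<times> T m)" by blast
    moreover have "finite \<dots>" using Suc by simp
    ultimately show ?case by (rule finite_subset)
  qed
  have "Nor n \<subseteq> T n"
    using distinct_card by (fastforce simp: Nor_def T_def)
  then show ?thesis using fin finite_subset by blast
qed

end

theory Submission
  imports Defs
begin

text \<open>The relations of the free Lie algebra with compatible brackets form a quadratic Groebner basis in
  the sense of shuffle operads.  On coloured normalized trees, the compatibility relation for the
  colours \<open>i \<le> j\<close> rewrites \<open>[[A, B]\<^sub>i, C]\<^sub>j\<close> with \<open>min A < min B < min C\<close> into smaller trees, so the
  irreducible trees are the ones in which the colour of \<open>L(x)\<close> exceeds that of \<open>x\<close> at every non-Lyndon node \<open>x\<close>.  The only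
  overlap of two leading terms is \<open>[[[A, P]\<^sub>h, Q]\<^sub>i, R]\<^sub>j\<close> with \<open>h \<le> i \<le> j\<close>, and it is resolved by the
  single syzygy between the Jacobi identities on four letters, summed over the distinct
  permutations of the three colours.  Hence the irreducible trees give a basis, over any field.
  The colours strictly decrease from a node of a block of the Lyndon partition to its parent in the
  block, so a colouring amounts to choosing a set of colours for every block,
  which is counted by a product of elementary symmetric functions.\<close>

section \<open>Linear extension\<close>

text \<open>Confluence serves only linear independence; spanning follows from rewriting alone. In
  place of a general theory of Groebner bases, a linear map \<open>nf\<close> is built by
  well-founded recursion, rewriting each reducible tree with an arbitrarily chosen relation. Two
  relations with the same leading tree differ by relations with smaller leading trees, so by
  induction \<open>nf\<close> annihilates all relations, while it fixes irreducible trees.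

  The obstacle is that the defining ideal lives on all bracketed words, with repeated letters and
  arguments in any order, whereas rewriting lives on normal trees. The map
  \<open>normal_word\<close> connects the two: it is a homomorphism to a bracket on the span of
  normal trees and carries the ideal into the span of the relations. A combination of irreducible
  trees in the ideal is then both fixed and annihilated.

  Independence of the field comes from monic relations. For equal colours a Jacobi identity is
  counted once, not twice, since its double would vanish in characteristic 2.\<close>

interpretation magma: vector_space
  "smul :: 'k::field \<Rightarrow> ('a, 'k) free_magma_alg \<Rightarrow> ('a, 'k) free_magma_alg"
  by standard (simp_all add: smul_module)

abbreviation sgl :: "'a bword \<Rightarrow> ('a, 'k::field) free_magma_alg" where
  "sgl t \<equiv> Poly_Mapping.single t 1"

lemma fbr_sgl: "fbr j (sgl s) (sgl t) = sgl (Br j s t)"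
  by (simp add: fbr_single)

lemma fbr_uminus_left: "fbr j (- p) q = - fbr j p q"
  using fbr_diff_left[of j 0 p q] by simp

lemma fbr_uminus_right: "fbr j p (- q) = - fbr j p q"
  using fbr_diff_right[of j p 0 q] by simp

lemmas fbr_linear = fbr_add_left fbr_add_right fbr_diff_left fbr_diff_right
  fbr_uminus_left fbr_uminus_right

definition lext :: "('a bword \<Rightarrow> ('b, 'k) free_magma_alg) \<Rightarrow> ('a, 'k::field) free_magma_alg
    \<Rightarrow> ('b, 'k) free_magma_alg" where
  "lext \<phi> p = (\<Sum>t\<in>Poly_Mapping.keys p. smul (Poly_Mapping.lookup p t) (\<phi> t))"

lemma lext_superset:
  "finite A \<Longrightarrow> Poly_Mapping.keys p \<subseteq> A \<Longrightarrow> lext \<phi> p = (\<Sum>t\<in>A. smul (Poly_Mapping.lookup p t) (\<phi> t))"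
  unfolding lext_def by (intro sum.mono_neutral_left) (auto simp: in_keys_iff)

lemma lext_add: "lext \<phi> (p + q) = lext \<phi> p + lext \<phi> q"
proof -
  let ?A = "Poly_Mapping.keys p \<union> Poly_Mapping.keys q"
  have "Poly_Mapping.keys (p + q) \<subseteq> ?A" by (rule keys_add)
  then show ?thesis
    by (simp add: lext_superset[where A = ?A] lookup_add magma.scale_left_distrib sum.distrib)
qed

lemma lext_smul: "lext \<phi> (smul c p) = smul c (lext \<phi> p)"
proof -
  have "Poly_Mapping.keys (smul c p) \<subseteq> Poly_Mapping.keys p" by (auto simp: in_keys_iff)
  then show ?thesis
    by (simp add: lext_superset[where A = "Poly_Mapping.keys p"] magma.scale_sum_right)
qed

lemma lext_0 [simp]: "lext \<phi> 0 = 0"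
  by (simp add: lext_def)

lemma lext_sgl [simp]: "lext \<phi> (sgl t) = \<phi> t"
  by (simp add: lext_def)

lemma lext_diff: "lext \<phi> (p - q) = lext \<phi> p - lext \<phi> q"
  using lext_add[of \<phi> "p - q" q] by simp

lemma lext_uminus: "lext \<phi> (- p) = - lext \<phi> p"
  using lext_diff[of \<phi> 0 p] by simp

lemmas lext_linear = lext_add lext_diff lext_uminus

lemma sgl_expansion:
  "p = (\<Sum>t\<in>Poly_Mapping.keys p. smul (Poly_Mapping.lookup p t) (sgl t))"
  using poly_mapping_sum_single[of p] by (simp add: smul_single)

text \<open>The predicate \<open>Q\<close> restricts the basis words, so that a linear claim need
  only be checked on single words of the kind at hand.\<close>

lemma linear_induct [consumes 1, case_names zero add smul sgl]:
  assumes "\<And>t. t \<in> Poly_Mapping.keys p \<Longrightarrow> Q t"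
    and "P 0" "\<And>p q. P p \<Longrightarrow> P q \<Longrightarrow> P (p + q)" "\<And>c p. P p \<Longrightarrow> P (smul c p)"
    and "\<And>t. Q t \<Longrightarrow> P (sgl t)"
  shows "P p"
proof -
  have "P (\<Sum>t\<in>A. smul (Poly_Mapping.lookup p t) (sgl t))"
    if "finite A" "A \<subseteq> Poly_Mapping.keys p" for A
    using that by (induction A) (auto intro: assms)
  from this[OF finite_keys order_refl] show ?thesis
    by (simp flip: sgl_expansion)
qed

section \<open>Normal coloured trees\<close>

text \<open>A normalized tree with coloured internal nodes is a bracketed word; the colour of a node is
  the type of the bracket.\<close>

primrec min_leaf :: "nat bword \<Rightarrow> nat" where
  "min_leaf (Gen a) = a"
| "min_leaf (Br j s t) = min (min_leaf s) (min_leaf t)"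

primrec normal :: "nat bword \<Rightarrow> bool" where
  "normal (Gen a) = True"
| "normal (Br j s t) = (normal s \<and> normal t \<and> set_bword s \<inter> set_bword t = {} \<and> min_leaf s < min_leaf t)"

primrec wt :: "'a bword \<Rightarrow> (nat \<Rightarrow>\<^sub>0 nat)" where
  "wt (Gen a) = 0"
| "wt (Br j s t) = Poly_Mapping.single j 1 + wt s + wt t"

lemma finite_set_bword [simp]: "finite (set_bword t)"
  by (induction t) auto

lemma min_leaf_in [simp]: "min_leaf t \<in> set_bword t"
  by (induction t) (auto simp: min_def)

lemma min_leaf_le: "l \<in> set_bword t \<Longrightarrow> min_leaf t \<le> l"
  by (induction t) (auto simp: min_le_iff_disj)

lemma less_min_leaf_notin: "k < min_leaf t \<Longrightarrow> k \<notin> set_bword t"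
  using min_leaf_le[of k t] by auto

lemma min_leaf_eq_Min: "min_leaf t = Min (set_bword t)"
  by (rule Min_eqI[symmetric]) (auto dest: min_leaf_le)

lemma min_leaf_cong: "set_bword s = set_bword t \<Longrightarrow> min_leaf s = min_leaf t"
  by (simp add: min_leaf_eq_Min)

lemma min_leaf_neq: "set_bword s \<inter> set_bword t = {} \<Longrightarrow> min_leaf s \<noteq> min_leaf t"
  by (metis disjoint_iff min_leaf_in)

section \<open>The path order\<close>

text \<open>Trees on the same leaf set are compared at the smallest leaf whose path (the sequence of
  colours from the root) differs, longer paths being larger.\<close>

primrec path :: "nat bword \<Rightarrow> nat \<Rightarrow> nat list" where
  "path (Gen a) l = []"
| "path (Br j s t) l = j # (if l \<in> set_bword s then path s l else path t l)"

definition path_less :: "nat bword \<Rightarrow> nat bword \<Rightarrow> bool" where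
  "path_less S T \<longleftrightarrow> set_bword S = set_bword T \<and>
    (\<exists>l\<in>set_bword T. (path S l, path T l) \<in> lenlex less_than \<and>
      (\<forall>k\<in>set_bword T. k < l \<longrightarrow> path S k = path T k))"

lemma path_less_set: "path_less S T \<Longrightarrow> set_bword S = set_bword T"
  by (simp add: path_less_def)

lemma path_less_min_leaf: "path_less S T \<Longrightarrow> min_leaf S = min_leaf T"
  by (intro min_leaf_cong path_less_set)

lemma path_lessI:
  assumes "set_bword S = set_bword T" "l \<in> set_bword T"
    "(path S l, path T l) \<in> lenlex less_than"
    "\<And>k. k \<in> set_bword T \<Longrightarrow> k < l \<Longrightarrow> path S k = path T k"
  shows "path_less S T"
  using assms by (auto simp: path_less_def)

text \<open>Compatibility with grafting: the leaf that witnesses the inequality still does, since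
  both of its paths get the same new first colour and the leaves of \<open>U\<close> have equal
  paths in both trees.\<close>

lemma path_less_left:
  assumes "path_less S T" "set_bword T \<inter> set_bword U = {}"
  shows "path_less (Br j S U) (Br j T U)"
proof -
  obtain l where l: "l \<in> set_bword T" "(path S l, path T l) \<in> lenlex less_than"
    "\<And>k. k \<in> set_bword T \<Longrightarrow> k < l \<Longrightarrow> path S k = path T k" and s: "set_bword S = set_bword T"
    using assms(1) by (auto simp: path_less_def)
  show ?thesis
    by (rule path_lessI[where l = l]) (use l s in \<open>auto simp: Cons_lenlex_iff dest: lenlex_length\<close>)
qed

lemma path_less_right:
  assumes "path_less S T" "set_bword T \<inter> set_bword U = {}"
  shows "path_less (Br j U S) (Br j U T)"
proof -
  obtain l where l: "l \<in> set_bword T" "(path S l, path T l) \<in> lenlex less_than"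
    "\<And>k. k \<in> set_bword T \<Longrightarrow> k < l \<Longrightarrow> path S k = path T k" and s: "set_bword S = set_bword T"
    using assms(1) by (auto simp: path_less_def)
  show ?thesis
    by (rule path_lessI[where l = l]) (use l s assms(2) in \<open>auto simp: Cons_lenlex_iff dest: lenlex_length\<close>)
qed

lemma lex_map_first_difference:
  assumes "sorted_wrt (<) xs" "l \<in> set xs" "(f l, g l) \<in> r"
    "\<And>k. k \<in> set xs \<Longrightarrow> k < l \<Longrightarrow> f k = g k"
  shows "(map f xs, map g xs) \<in> lex r"
proof -
  obtain ys zs where xs: "xs = ys @ l # zs"
    using split_list[OF assms(2)] by blast
  have "map f ys = map g ys"
    using assms(1,4) by (auto simp: xs sorted_wrt_append)
  then have "(map f xs, map g xs) = (map g ys @ f l # map f zs, map g ys @ g l # map g zs)"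
    by (simp add: xs)
  also have "\<dots> \<in> lex r"
    using assms(3) unfolding lex_conv by force
  finally show ?thesis .
qed

lemma wf_path_less: "wf {(S, T). path_less S T}"
proof (rule wf_subset)
  \<comment> \<open>\<open>lex\<close> relates only lists of equal length, which keeps it
    well-founded; trees with the same leaf set do give lists of equal length.\<close>
  let ?f = "\<lambda>T. map (path T) (sorted_list_of_set (set_bword T))"
  show "wf (inv_image (lex (lenlex less_than)) ?f)"
    by (intro wf_inv_image wf_lex wf_lenlex wf_less_than)
  show "{(S, T). path_less S T} \<subseteq> inv_image (lex (lenlex less_than)) ?f"
  proof clarify
    fix S T assume "path_less S T"
    then show "(S, T) \<in> inv_image (lex (lenlex less_than)) ?f"
      unfolding path_less_def by (auto intro: lex_map_first_difference[OF strict_sorted_list_of_set])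
  qed
qed

section \<open>The rewriting relations\<close>

text \<open>The Jacobi identity, rewritten by antisymmetry so that all three terms are normal when
  the smallest leaves of \<open>a\<close>, \<open>b\<close>, \<open>c\<close> increase. The inner
  colour is \<open>x\<close>, the outer one \<open>y\<close>.\<close>

definition jacobi_defect :: "('a, 'k::field) free_magma_alg \<Rightarrow> ('a, 'k) free_magma_alg \<Rightarrow> ('a, 'k) free_magma_alg
    \<Rightarrow> nat \<Rightarrow> nat \<Rightarrow> ('a, 'k) free_magma_alg" where
  "jacobi_defect a b c x y = fbr y (fbr x a b) c - fbr y (fbr x a c) b - fbr y a (fbr x b c)"

text \<open>Symmetric in the two colours. For \<open>i = j\<close> it is the Jacobi identity taken
  once, so that the leading coefficient is 1 in every characteristic.\<close>

definition compat_rel :: "('a, 'k::field) free_magma_alg \<Rightarrow> ('a, 'k) free_magma_alg \<Rightarrow> ('a, 'k) free_magma_alg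
    \<Rightarrow> nat \<Rightarrow> nat \<Rightarrow> ('a, 'k) free_magma_alg" where
  "compat_rel a b c i j = jacobi_defect a b c i j + (if i = j then 0 else jacobi_defect a b c j i)"

lemma compat_rel_linear:
  "compat_rel (a - a') b c i j = compat_rel a b c i j - compat_rel a' b c i j"
  "compat_rel a (b - b') c i j = compat_rel a b c i j - compat_rel a b' c i j"
  "compat_rel a b (c - c') i j = compat_rel a b c i j - compat_rel a b c' i j"
  "compat_rel (a + a') b c i j = compat_rel a b c i j + compat_rel a' b c i j"
  "compat_rel a (b + b') c i j = compat_rel a b c i j + compat_rel a b' c i j"
  "compat_rel a b (c + c') i j = compat_rel a b c i j + compat_rel a b c' i j"
  "compat_rel (smul k a) b c i j = smul k (compat_rel a b c i j)"
  "compat_rel a (smul k b) c i j = smul k (compat_rel a b c i j)"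
  "compat_rel a b (smul k c) i j = smul k (compat_rel a b c i j)"
  by (simp_all add: compat_rel_def jacobi_defect_def fbr_linear fbr_smul_left fbr_smul_right smul_module algebra_simps)

lemma compat_rel_0 [simp]: "compat_rel 0 b c i j = 0" "compat_rel a 0 c i j = 0" "compat_rel a b 0 i j = 0"
  by (simp_all add: compat_rel_def jacobi_defect_def)

text \<open>The relations with leading term \<open>T\<close>, one for each position of \<open>T\<close> that violates the Lyndon
  condition.\<close>

primrec rels :: "nat bword \<Rightarrow> (nat, 'k::field) free_magma_alg set" where
  "rels (Gen a) = {}"
| "rels (Br k S U) = {fbr k f (sgl U) | f. f \<in> rels S} \<union> {fbr k (sgl S) g | g. g \<in> rels U} \<union>
    {compat_rel (sgl A) (sgl B) (sgl U) i k | i A B. S = Br i A B \<and> min_leaf B < min_leaf U \<and> i \<le> k}"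

lemma rels_left: "f \<in> rels S \<Longrightarrow> fbr k f (sgl U) \<in> rels (Br k S U)"
  by auto

lemma rels_right: "g \<in> rels U \<Longrightarrow> fbr k (sgl S) g \<in> rels (Br k S U)"
  by auto

lemma rels_base: "min_leaf B < min_leaf C \<Longrightarrow> i \<le> j \<Longrightarrow> compat_rel (sgl A) (sgl B) (sgl C) i j \<in> rels (Br j (Br i A B) C)"
  by auto

text \<open>Rewriting must preserve normality, the leaf set (part of \<open>path_less\<close>) and
  the colours, so that it stays within one multidegree.\<close>

definition lower :: "nat bword \<Rightarrow> nat bword \<Rightarrow> bool" where
  "lower U T \<longleftrightarrow> normal U \<and> path_less U T \<and> wt U = wt T"

lemma lower_left:
  assumes "lower S' S" "normal (Br k S U)"
  shows "lower (Br k S' U) (Br k S U)"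
  using assms path_less_left[of S' S U k] path_less_set[of S' S] path_less_min_leaf[of S' S] by (auto simp: lower_def)

lemma lower_right:
  assumes "lower S' S" "normal (Br k U S)"
  shows "lower (Br k U S') (Br k U S)"
  using assms path_less_right[of S' S U k] path_less_set[of S' S] path_less_min_leaf[of S' S] by (auto simp: lower_def)

text \<open>The comparison takes place at the smallest leaf of \<open>A\<close>, whose path gets
  shorter or starts with a smaller colour. Only if \<open>A\<close> keeps its path does the smallest
  leaf of \<open>B\<close> decide: its path loses a node when \<open>B\<close> and \<open>C\<close>
  are exchanged.\<close>

lemma lower_three:
  assumes "normal (Br j (Br i A B) C)" "min_leaf B < min_leaf C" "{#x, y#} = {#i, j#}"
  shows "y \<le> j \<Longrightarrow> lower (Br y (Br x A C) B) (Br j (Br i A B) C)"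
    and "lower (Br y A (Br x B C)) (Br j (Br i A B) C)"
    and "y < j \<Longrightarrow> lower (Br y (Br x A B) C) (Br j (Br i A B) C)"
proof -
  have dis: "min_leaf B \<notin> set_bword A" "min_leaf B \<notin> set_bword C" "min_leaf C \<notin> set_bword A"
    using assms(1) min_leaf_in[of B] min_leaf_in[of C] unfolding normal.simps disjoint_iff by auto
  have xy: "(x = i \<and> y = j) \<or> (x = j \<and> y = i)"
    using assms(3) by (auto simp: add_eq_conv_ex)
  have wt: "Poly_Mapping.single x (1::nat) + Poly_Mapping.single y 1 =
      Poly_Mapping.single i 1 + Poly_Mapping.single j 1"
    using xy by (auto simp: add.commute)
  have wt': "Poly_Mapping.single x (1::nat) + (Poly_Mapping.single y 1 + u) =
      Poly_Mapping.single i 1 + (Poly_Mapping.single j 1 + u)" for u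
    using wt by (simp flip: add.assoc)
  show "lower (Br y (Br x A C) B) (Br j (Br i A B) C)" if "y \<le> j"
  proof -
    have "path_less (Br y (Br x A C) B) (Br j (Br i A B) C)"
    proof (cases "y = j")
      case True
      with xy have "x = i" by auto
      with True show ?thesis
        by (intro path_lessI[where l = "min_leaf B"]) (use assms dis in \<open>auto simp: Cons_lenlex_iff min_def less_min_leaf_notin\<close>)
    next
      case False
      with that show ?thesis
        by (intro path_lessI[where l = "min_leaf A"]) (use assms dis in \<open>auto simp: Cons_lenlex_iff min_def less_min_leaf_notin\<close>)
    qed
    then show ?thesis
      using assms wt' by (auto simp: lower_def ac_simps)
  qed
  show "lower (Br y A (Br x B C)) (Br j (Br i A B) C)"
  proof -
    have "path_less (Br y A (Br x B C)) (Br j (Br i A B) C)"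
      by (intro path_lessI[where l = "min_leaf A"]) (use assms dis in \<open>auto simp: Cons_lenlex_iff min_def less_min_leaf_notin\<close>)
    then show ?thesis
      using assms wt' by (auto simp: lower_def ac_simps)
  qed
  show "lower (Br y (Br x A B) C) (Br j (Br i A B) C)" if "y < j"
  proof -
    have "path_less (Br y (Br x A B) C) (Br j (Br i A B) C)"
      by (intro path_lessI[where l = "min_leaf A"]) (use assms dis that in \<open>auto simp: Cons_lenlex_iff min_def less_min_leaf_notin\<close>)
    then show ?thesis
      using assms wt' by (auto simp: lower_def ac_simps)
  qed
qed

lemma lower_tails_of:
  assumes "normal (Br j (Br i A B) C)" "min_leaf B < min_leaf C" "i \<le> j"
  shows "lower (Br j (Br i A C) B) (Br j (Br i A B) C)"
    and "lower (Br j A (Br i B C)) (Br j (Br i A B) C)"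
    and "i \<noteq> j \<Longrightarrow> lower (Br i (Br j A C) B) (Br j (Br i A B) C)"
    and "i \<noteq> j \<Longrightarrow> lower (Br i A (Br j B C)) (Br j (Br i A B) C)"
    and "i \<noteq> j \<Longrightarrow> lower (Br i (Br j A B) C) (Br j (Br i A B) C)"
  using assms(3) lower_three[OF assms(1,2), of i j] lower_three[OF assms(1,2), of j i]
  by (auto simp: add_mset_commute)

section \<open>Tails of relations, and spans of relations with smaller leading trees\<close>

definition lows :: "nat bword \<Rightarrow> (nat, 'k::field) free_magma_alg set" where
  "lows T = {p. \<forall>U\<in>Poly_Mapping.keys p. lower U T}"

lemma lows_0: "0 \<in> lows T"
  by (simp add: lows_def)

lemma lows_sgl: "lower U T \<Longrightarrow> sgl U \<in> lows T"
  by (simp add: lows_def)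

lemma lows_add: "p \<in> lows T \<Longrightarrow> q \<in> lows T \<Longrightarrow> p + q \<in> lows T"
  using keys_add[of p q] by (force simp: lows_def)

lemma lows_diff: "p \<in> lows T \<Longrightarrow> q \<in> lows T \<Longrightarrow> p - q \<in> lows T"
  using keys_diff[of p q] by (force simp: lows_def)

lemma lows_smul: "p \<in> lows T \<Longrightarrow> smul c p \<in> lows T"
  by (auto simp: lows_def in_keys_iff)

lemma lows_uminus: "p \<in> lows T \<Longrightarrow> - p \<in> lows T"
  using lows_diff[of 0 T p] by (simp add: lows_0)

lemma lows_induct [consumes 1, case_names zero add smul sgl]:
  assumes "p \<in> lows T" "P 0" "\<And>p q. P p \<Longrightarrow> P q \<Longrightarrow> P (p + q)" "\<And>c p. P p \<Longrightarrow> P (smul c p)"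
    "\<And>U. lower U T \<Longrightarrow> P (sgl U)"
  shows "P p"
  by (rule linear_induct[where Q = "\<lambda>U. lower U T"]) (use assms in \<open>auto simp: lows_def\<close>)

lemma lows_fbr_left: "p \<in> lows S \<Longrightarrow> normal (Br k S U) \<Longrightarrow> fbr k p (sgl U) \<in> lows (Br k S U)"
  by (induction p rule: lows_induct)
    (simp_all add: fbr_linear fbr_smul_left fbr_sgl lows_0 lows_add lows_smul lows_sgl lower_left)

lemma lows_fbr_right: "p \<in> lows S \<Longrightarrow> normal (Br k U S) \<Longrightarrow> fbr k (sgl U) p \<in> lows (Br k U S)"
  by (induction p rule: lows_induct)
    (simp_all add: fbr_linear fbr_smul_right fbr_sgl lows_0 lows_add lows_smul lows_sgl lower_right)

text \<open>This justifies calling \<open>T\<close> the leading term, with coefficient 1: every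
  relation in \<open>rels T\<close> rewrites \<open>T\<close> without division.\<close>

lemma rels_tail: "normal T \<Longrightarrow> f \<in> rels T \<Longrightarrow> f - sgl T \<in> lows T"
proof (induction T arbitrary: f)
  case (Br k S U)
  from Br.prems(2) consider
    (left) g where "g \<in> rels S" "f = fbr k g (sgl U)"
    | (right) g where "g \<in> rels U" "f = fbr k (sgl S) g"
    | (base) i A B where "S = Br i A B" "min_leaf B < min_leaf U" "i \<le> k" "f = compat_rel (sgl A) (sgl B) (sgl U) i k"
    by auto
  then show ?case
  proof cases
    case left
    have "fbr k (g - sgl S) (sgl U) \<in> lows (Br k S U)"
      using Br left by (intro lows_fbr_left) auto
    then show ?thesis by (simp add: left fbr_linear fbr_sgl)
  next
    case right
    have "fbr k (sgl S) (g - sgl U) \<in> lows (Br k S U)"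
      using Br right by (intro lows_fbr_right) auto
    then show ?thesis by (simp add: right fbr_linear fbr_sgl)
  next
    case base
    let ?T = "Br k (Br i A B) U"
    note l = lower_tails_of[OF Br.prems(1)[unfolded base(1)] base(2,3)]
    have "f - sgl ?T = (if i = k then 0 else sgl (Br i (Br k A B) U) - sgl (Br i (Br k A U) B) - sgl (Br i A (Br k B U)))
       - sgl (Br k (Br i A U) B) - sgl (Br k A (Br i B U))"
      by (simp add: base compat_rel_def jacobi_defect_def fbr_sgl)
    also have "\<dots> \<in> lows ?T"
      using l by (auto intro!: lows_diff lows_uminus lows_0 lows_sgl)
    finally show ?thesis by (simp add: base)
  qed
qed simp

text \<open>The target of confluence: combinations of relations whose leading trees are all below
  \<open>T\<close>. In contrast, \<open>lows\<close> contains arbitrary combinations of trees below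
  \<open>T\<close>.\<close>

definition low :: "nat bword \<Rightarrow> (nat, 'k::field) free_magma_alg set" where
  "low T = magma.span (\<Union>U\<in>{U. lower U T}. rels U)"

lemma lowI: "f \<in> rels U \<Longrightarrow> lower U T \<Longrightarrow> f \<in> low T"
  unfolding low_def by (rule magma.span_base) auto

lemma low_0: "0 \<in> low T"
  unfolding low_def by (rule magma.span_zero)

lemma low_add: "p \<in> low T \<Longrightarrow> q \<in> low T \<Longrightarrow> p + q \<in> low T"
  unfolding low_def by (rule magma.span_add)

lemma low_diff: "p \<in> low T \<Longrightarrow> q \<in> low T \<Longrightarrow> p - q \<in> low T"
  unfolding low_def by (rule magma.span_diff)

lemma low_uminus: "p \<in> low T \<Longrightarrow> - p \<in> low T"
  unfolding low_def by (rule magma.span_neg)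

lemma low_smul: "p \<in> low T \<Longrightarrow> smul c p \<in> low T"
  unfolding low_def by (rule magma.span_scale)

lemma low_sum: "(\<And>x. x \<in> A \<Longrightarrow> f x \<in> low T) \<Longrightarrow> sum f A \<in> low T"
  unfolding low_def by (rule magma.span_sum)

lemma low_induct [consumes 1, case_names zero step]:
  assumes "p \<in> low T" "P 0" "\<And>c f p U. f \<in> rels U \<Longrightarrow> lower U T \<Longrightarrow> P p \<Longrightarrow> P (smul c f + p)"
  shows "P p"
  using assms(1) unfolding low_def
  by (induction rule: magma.span_induct_alt) (auto intro: assms)

lemma low_fbr_left: "p \<in> low S \<Longrightarrow> normal (Br k S U) \<Longrightarrow> fbr k p (sgl U) \<in> low (Br k S U)"
  by (induction p rule: low_induct)
    (auto simp: fbr_linear fbr_smul_left intro!: low_0 low_add low_smul intro: lowI[OF rels_left] lower_left simp del: normal.simps)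

lemma low_fbr_right: "p \<in> low S \<Longrightarrow> normal (Br k U S) \<Longrightarrow> fbr k (sgl U) p \<in> low (Br k U S)"
  by (induction p rule: low_induct)
    (auto simp: fbr_linear fbr_smul_right intro!: low_0 low_add low_smul intro: lowI[OF rels_right] lower_right simp del: normal.simps)

text \<open>Each tree \<open>V\<close> occurring in \<open>p\<close> turns \<open>f\<close> into a
  relation with leading tree \<open>Br k V U\<close>, which is below
  \<open>Br k S U\<close>.\<close>

lemma lows_fbr_rels: "p \<in> lows S \<Longrightarrow> f \<in> rels U \<Longrightarrow> normal (Br k S U) \<Longrightarrow> fbr k p f \<in> low (Br k S U)"
  by (induction p rule: lows_induct)
    (auto simp: fbr_linear fbr_smul_left intro!: low_0 low_add low_smul intro: lowI[OF rels_right] lower_left simp del: normal.simps)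

lemma rels_fbr_lows: "p \<in> lows U \<Longrightarrow> f \<in> rels S \<Longrightarrow> normal (Br k S U) \<Longrightarrow> fbr k f p \<in> low (Br k S U)"
  by (induction p rule: lows_induct)
    (auto simp: fbr_linear fbr_smul_right intro!: low_0 low_add low_smul intro: lowI[OF rels_left] lower_right simp del: normal.simps)

section \<open>Confluence\<close>

text \<open>The analogue of Buchberger's product criterion: add and subtract
  \<open>fbr k f g\<close>, and each half contains the tail of one of the two relations.\<close>

lemma confluence_disjoint:
  assumes "f \<in> rels S" "g \<in> rels U" "normal (Br k S U)"
  shows "fbr k f (sgl U) - fbr k (sgl S) g \<in> low (Br k S U)"
proof -
  have "f - sgl S \<in> lows S" "g - sgl U \<in> lows U"
    using assms by (auto intro: rels_tail)
  then have "fbr k (f - sgl S) g \<in> low (Br k S U)" "fbr k f (g - sgl U) \<in> low (Br k S U)"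
    using lows_fbr_rels rels_fbr_lows assms by blast+
  then have "fbr k (f - sgl S) g - fbr k f (g - sgl U) \<in> low (Br k S U)"
    by (rule low_diff)
  then show ?thesis by (simp add: fbr_linear)
qed

section \<open>The root relation against a relation inside one of its three subtrees\<close>

context
  fixes A B C :: "nat bword" and i j :: nat
  assumes T: "normal (Br j (Br i A B) C)" "min_leaf B < min_leaf C" "i \<le> j"
begin

abbreviation (input) "T3 \<equiv> Br j (Br i A B) C"

lemmas lower_tails = lower_tails_of[OF T]

text \<open>Substitute \<open>g\<close> for \<open>C\<close> in the root relation. All resulting
  terms other than the leading one are relations with smaller leading trees. The error, with the
  tail of \<open>g\<close> in place of \<open>C\<close>, consists of root relations again, since the
  trees in the tail have the same smallest leaf. The next two lemmas substitute for \<open>B\<close>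
  and \<open>A\<close>.\<close>

lemma confluence_right_leaf:
  assumes g: "g \<in> rels C"
  shows "compat_rel (sgl A) (sgl B) (sgl C) i j - fbr j (sgl (Br i A B)) g \<in> low T3"
proof -
  have "compat_rel (sgl A) (sgl B) p i j \<in> low T3" if "p \<in> lows C" for p
    using that
  proof (induction p rule: lows_induct)
    case (sgl U)
    have "lower (Br j (Br i A B) U) T3" using sgl T by (auto intro: lower_right)
    then show ?case
      using T path_less_min_leaf[of U C] sgl by (intro lowI[OF rels_base]) (auto simp: lower_def)
  qed (auto simp: compat_rel_linear low_0 low_add low_smul)
  then have 1: "compat_rel (sgl A) (sgl B) (g - sgl C) i j \<in> low T3"
    using g T rels_tail[of C g] by auto
  have "compat_rel (sgl A) (sgl B) (sgl C) i j - fbr j (sgl (Br i A B)) g =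
     (if i = j then 0 else fbr i (sgl (Br j A B)) g - fbr i (fbr j (sgl A) g) (sgl B) - fbr i (sgl A) (fbr j (sgl B) g))
      - fbr j (fbr i (sgl A) g) (sgl B) - fbr j (sgl A) (fbr i (sgl B) g)
      - compat_rel (sgl A) (sgl B) (g - sgl C) i j"
    by (simp add: compat_rel_linear fbr_sgl) (simp add: compat_rel_def jacobi_defect_def fbr_sgl)
  also have "\<dots> \<in> low T3"
    using g 1 lower_tails
    by (auto intro!: low_diff low_uminus low_0 intro: lowI rels_left rels_right simp del: rels.simps)
  finally show ?thesis .
qed

lemma confluence_middle_leaf:
  assumes g: "g \<in> rels B"
  shows "compat_rel (sgl A) (sgl B) (sgl C) i j - fbr j (fbr i (sgl A) g) (sgl C) \<in> low T3"
proof -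
  have "compat_rel (sgl A) p (sgl C) i j \<in> low T3" if "p \<in> lows B" for p
    using that
  proof (induction p rule: lows_induct)
    case (sgl U)
    have "lower (Br j (Br i A U) C) T3" using sgl T by (auto intro!: lower_right lower_left)
    then show ?case
      using T path_less_min_leaf[of U B] sgl by (intro lowI[OF rels_base]) (auto simp: lower_def)
  qed (auto simp: compat_rel_linear low_0 low_add low_smul)
  then have 1: "compat_rel (sgl A) (g - sgl B) (sgl C) i j \<in> low T3"
    using g T rels_tail[of B g] by auto
  have "compat_rel (sgl A) (sgl B) (sgl C) i j - fbr j (fbr i (sgl A) g) (sgl C) =
     (if i = j then 0 else fbr i (fbr j (sgl A) g) (sgl C) - fbr i (sgl (Br j A C)) g - fbr i (sgl A) (fbr j g (sgl C)))
      - fbr j (sgl (Br i A C)) g - fbr j (sgl A) (fbr i g (sgl C))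
      - compat_rel (sgl A) (g - sgl B) (sgl C) i j"
    by (simp add: compat_rel_linear fbr_sgl) (simp add: compat_rel_def jacobi_defect_def fbr_sgl)
  also have "\<dots> \<in> low T3"
    using g 1 lower_tails
    by (auto intro!: low_diff low_uminus low_0 intro: lowI rels_left rels_right simp del: rels.simps)
  finally show ?thesis .
qed

lemma confluence_left_leaf:
  assumes g: "g \<in> rels A"
  shows "compat_rel (sgl A) (sgl B) (sgl C) i j - fbr j (fbr i g (sgl B)) (sgl C) \<in> low T3"
proof -
  have "compat_rel p (sgl B) (sgl C) i j \<in> low T3" if "p \<in> lows A" for p
    using that
  proof (induction p rule: lows_induct)
    case (sgl U)
    have "lower (Br j (Br i U B) C) T3" using sgl T by (auto intro!: lower_right lower_left)
    then show ?case
      using T sgl by (intro lowI[OF rels_base]) (auto simp: lower_def)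
  qed (auto simp: compat_rel_linear low_0 low_add low_smul)
  then have 1: "compat_rel (g - sgl A) (sgl B) (sgl C) i j \<in> low T3"
    using g T rels_tail[of A g] by auto
  have "compat_rel (sgl A) (sgl B) (sgl C) i j - fbr j (fbr i g (sgl B)) (sgl C) =
     (if i = j then 0 else fbr i (fbr j g (sgl B)) (sgl C) - fbr i (fbr j g (sgl C)) (sgl B) - fbr i g (sgl (Br j B C)))
      - fbr j (fbr i g (sgl C)) (sgl B) - fbr j g (sgl (Br i B C))
      - compat_rel (g - sgl A) (sgl B) (sgl C) i j"
    by (simp add: compat_rel_linear fbr_sgl) (simp add: compat_rel_def jacobi_defect_def fbr_sgl)
  also have "\<dots> \<in> low T3"
    using g 1 lower_tails
    by (auto intro!: low_diff low_uminus low_0 intro: lowI rels_left rels_right simp del: rels.simps)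
  finally show ?thesis .
qed

end

text \<open>The balanced trees, the only terms that survive in the syzygy: each occurs with both
  assignments of \<open>x\<close> and \<open>y\<close> to its two inner brackets, with opposite
  signs.\<close>

definition syzygy_remainder :: "('a, 'k::field) free_magma_alg \<Rightarrow> ('a, 'k) free_magma_alg \<Rightarrow> ('a, 'k) free_magma_alg \<Rightarrow>
    ('a, 'k) free_magma_alg \<Rightarrow> nat \<Rightarrow> nat \<Rightarrow> nat \<Rightarrow> ('a, 'k) free_magma_alg" where
  "syzygy_remainder a p q r x y z =
    fbr z (fbr x a p) (fbr y q r) - fbr z (fbr x a q) (fbr y p r) + fbr z (fbr x a r) (fbr y p q)"

text \<open>The right-hand side is antisymmetric in \<open>x\<close> and \<open>y\<close>, so it cancels when summed over all
  arrangements of three colours.\<close>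

lemma syzygy:
  "fbr z (jacobi_defect a p q x y) r - fbr z (jacobi_defect a p r x y) q + fbr z (jacobi_defect a q r x y) p + fbr z a (jacobi_defect p q r x y)
    - jacobi_defect (fbr x a p) q r y z + jacobi_defect (fbr x a q) p r y z - jacobi_defect (fbr x a r) p q y z
    + jacobi_defect a (fbr x p q) r y z - jacobi_defect a (fbr x p r) q y z - jacobi_defect a p (fbr x q r) y z
   = syzygy_remainder a p q r x y z - syzygy_remainder a p q r y x z"
  by (simp add: jacobi_defect_def syzygy_remainder_def fbr_linear)

lemma sum_swap_invariant:
  fixes f :: "nat \<Rightarrow> nat \<Rightarrow> nat \<Rightarrow> 'b::comm_monoid_add"
  assumes "\<And>x y z. (x, y, z) \<in> P \<Longrightarrow> (y, x, z) \<in> P"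
  shows "(\<Sum>(x, y, z)\<in>P. f x y z) = (\<Sum>(x, y, z)\<in>P. f y x z)"
  by (rule sum.reindex_bij_witness[where i = "\<lambda>(x, y, z). (y, x, z)" and j = "\<lambda>(x, y, z). (y, x, z)"])
    (auto intro: assms)

text \<open>Collects Jacobi defects into compatibility relations. An orbit of the swap has a single
  element exactly for \<open>x = y\<close>, which is the case distinction in
  \<open>compat_rel\<close>. The next lemma does this for the other pair of positions.\<close>

lemma sum_sorted_pairs12:
  fixes f :: "nat \<Rightarrow> nat \<Rightarrow> nat \<Rightarrow> 'b::comm_monoid_add"
  assumes "finite P" "\<And>x y z. (x, y, z) \<in> P \<Longrightarrow> (y, x, z) \<in> P"
  shows "(\<Sum>(x, y, z)\<in>P. f x y z) =
    (\<Sum>(x, y, z)\<in>{(x, y, z)\<in>P. x \<le> y}. f x y z + (if x = y then 0 else f y x z))"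
proof -
  have "(\<Sum>(x, y, z)\<in>P. f x y z) =
     (\<Sum>(x, y, z)\<in>{(x, y, z)\<in>P. x \<le> y}. f x y z) + (\<Sum>(x, y, z)\<in>{(x, y, z)\<in>P. \<not> x \<le> y}. f x y z)"
    using sum.Int_Diff[OF assms(1), of "\<lambda>(x, y, z). f x y z" "{(x, y, z). x \<le> y}"]
    by (simp add: Int_def set_diff_eq case_prod_unfold)
  also have "(\<Sum>(x, y, z)\<in>{(x, y, z)\<in>P. \<not> x \<le> y}. f x y z) =
     (\<Sum>(x, y, z)\<in>{(x, y, z)\<in>P. x \<le> y \<and> x \<noteq> y}. f y x z)"
    by (rule sum.reindex_bij_witness[where i = "\<lambda>(x, y, z). (y, x, z)" and j = "\<lambda>(x, y, z). (y, x, z)"])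
      (auto intro: assms)
  also have "\<dots> = (\<Sum>(x, y, z)\<in>{(x, y, z)\<in>P. x \<le> y}. if x = y then 0 else f y x z)"
  proof (rule sum.mono_neutral_cong_left)
    show "finite {(x, y, z)\<in>P. x \<le> y}"
      by (rule finite_subset[OF _ assms(1)]) auto
  qed auto
  finally show ?thesis
    by (simp add: sum.distrib[symmetric] case_prod_unfold)
qed

lemma sum_sorted_pairs23:
  fixes f :: "nat \<Rightarrow> nat \<Rightarrow> nat \<Rightarrow> 'b::comm_monoid_add"
  assumes "finite P" "\<And>x y z. (x, y, z) \<in> P \<Longrightarrow> (x, z, y) \<in> P"
  shows "(\<Sum>(x, y, z)\<in>P. f x y z) =
    (\<Sum>(x, y, z)\<in>{(x, y, z)\<in>P. y \<le> z}. f x y z + (if y = z then 0 else f x z y))"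
proof -
  have "(\<Sum>(x, y, z)\<in>P. f x y z) =
     (\<Sum>(x, y, z)\<in>{(x, y, z)\<in>P. y \<le> z}. f x y z) + (\<Sum>(x, y, z)\<in>{(x, y, z)\<in>P. \<not> y \<le> z}. f x y z)"
    using sum.Int_Diff[OF assms(1), of "\<lambda>(x, y, z). f x y z" "{(x, y, z). y \<le> z}"]
    by (simp add: Int_def set_diff_eq case_prod_unfold)
  also have "(\<Sum>(x, y, z)\<in>{(x, y, z)\<in>P. \<not> y \<le> z}. f x y z) =
     (\<Sum>(x, y, z)\<in>{(x, y, z)\<in>P. y \<le> z \<and> y \<noteq> z}. f x z y)"
    by (rule sum.reindex_bij_witness[where i = "\<lambda>(x, y, z). (x, z, y)" and j = "\<lambda>(x, y, z). (x, z, y)"])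
      (auto intro: assms)
  also have "\<dots> = (\<Sum>(x, y, z)\<in>{(x, y, z)\<in>P. y \<le> z}. if y = z then 0 else f x z y)"
  proof (rule sum.mono_neutral_cong_left)
    show "finite {(x, y, z)\<in>P. y \<le> z}"
      by (rule finite_subset[OF _ assms(1)]) auto
  qed auto
  finally show ?thesis
    by (simp add: sum.distrib[symmetric] case_prod_unfold)
qed

text \<open>Here \<open>m\<close> and \<open>m'\<close> will be the two overlapping relations, and
  the other summands belong to \<open>low\<close>.\<close>

lemma leading_difference:
  fixes x :: "'b::ab_group_add"
  assumes "y - y' + x = 0" "y = m + z" "y' = m' + z'"
  shows "m' - m = z - z' + x"
proof -
  have "x = y' - y"
    using eq_neg_iff_add_eq_0[of x "y - y'"] assms(1) by (simp add: add.commute)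
  then show ?thesis by (simp add: assms(2,3))
qed

section \<open>The overlap of two consecutive reducible nodes\<close>

context
  fixes A P Q R :: "nat bword" and h i j :: nat
  assumes T: "normal (Br j (Br i (Br h A P) Q) R)" "min_leaf P < min_leaf Q" "min_leaf Q < min_leaf R" "h \<le> i" "i \<le> j"
begin

abbreviation (input) "T4 \<equiv> Br j (Br i (Br h A P) Q) R"

text \<open>A set, so that arrangements which agree because of equal colours count once; the two
  overlapping relations thus get coefficients 1 and -1.\<close>

definition perms3 :: "(nat \<times> nat \<times> nat) set" where
  "perms3 = {(h, i, j), (h, j, i), (i, h, j), (i, j, h), (j, h, i), (j, i, h)}"

lemma perms3_swap: "(x, y, z) \<in> perms3 \<Longrightarrow> (y, x, z) \<in> perms3" "(x, y, z) \<in> perms3 \<Longrightarrow> (x, z, y) \<in> perms3"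
  by (auto simp: perms3_def)

lemma finite_perms3 [simp]: "finite perms3"
  by (simp add: perms3_def)

text \<open>Read from the root, the given arrangement is the lexicographically largest one, so every
  other arrangement lowers the path of \<open>A\<close>.\<close>

lemma perms3_lex:
  assumes "(x, y, z) \<in> perms3"
  shows "(z, y, x) = (j, i, h) \<or> z < j \<or> z = j \<and> (y < i \<or> y = i \<and> x < h)"
  using assms T(4,5) by (auto simp: perms3_def)

lemma perms3_wt:
  assumes "(x, y, z) \<in> perms3"
  shows "Poly_Mapping.single x (1::nat) + (Poly_Mapping.single y 1 + (Poly_Mapping.single z 1 + u)) =
      Poly_Mapping.single h 1 + (Poly_Mapping.single i 1 + (Poly_Mapping.single j 1 + u))"
  using assms by (auto simp: perms3_def ac_simps)

lemma four_disjoint: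
  "min_leaf P \<notin> set_bword A" "min_leaf P \<notin> set_bword Q" "min_leaf P \<notin> set_bword R" "min_leaf Q \<notin> set_bword A"
  "min_leaf Q \<notin> set_bword P" "min_leaf Q \<notin> set_bword R" "min_leaf R \<notin> set_bword A" "min_leaf R \<notin> set_bword P"
  "min_leaf R \<notin> set_bword Q" "min_leaf A < min_leaf P" "min_leaf A < min_leaf Q" "min_leaf A < min_leaf R" "min_leaf P < min_leaf R"
  using T min_leaf_in[of P] min_leaf_in[of Q] min_leaf_in[of R] unfolding normal.simps disjoint_iff by auto

lemma lower4I:
  assumes "(x, y, z) \<in> perms3" "normal U" "path_less U T4"
    "wt U = Poly_Mapping.single x 1 + (Poly_Mapping.single y 1 + (Poly_Mapping.single z 1 + (wt A + (wt P + (wt Q + wt R)))))"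
  shows "lower U T4"
  using assms perms3_wt[OF assms(1)] by (auto simp: lower_def ac_simps)

lemma lower_colours:
  assumes xyz: "(x, y, z) \<in> perms3" "(x, y, z) \<noteq> (h, i, j)"
  shows "lower (Br z (Br y (Br x A P) Q) R) T4"
proof -
  have "path_less (Br z (Br y (Br x A P) Q) R) T4"
    using perms3_lex[OF xyz(1)] xyz(2) T four_disjoint
    by (intro path_lessI[where l = "min_leaf A"]) (auto simp: Cons_lenlex_iff min_def less_min_leaf_notin)
  then show ?thesis
    using T by (intro lower4I[OF xyz(1)]) (auto simp: ac_simps)
qed

text \<open>The path of \<open>A\<close> keeps its length. If its colours agree too, the path of
  \<open>Q\<close> (first tree) or of \<open>P\<close> (the others) has become shorter.\<close>

lemma lower_long:
  assumes xyz: "(x, y, z) \<in> perms3"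
  shows "lower (Br z (Br y (Br x A P) R) Q) T4" (is "lower ?U1 _")
    and "lower (Br z (Br y (Br x A Q) P) R) T4" (is "lower ?U2 _")
    and "lower (Br z (Br y (Br x A Q) R) P) T4" (is "lower ?U3 _")
    and "lower (Br z (Br y (Br x A R) P) Q) T4" (is "lower ?U4 _")
proof -
  have "path_less ?U1 T4 \<and> path_less ?U2 T4 \<and> path_less ?U3 T4 \<and> path_less ?U4 T4"
  proof (cases "(z, y, x) = (j, i, h)")
    case True
    have "path_less ?U1 T4"
      using True T four_disjoint
      by (intro path_lessI[where l = "min_leaf Q"]) (auto simp: Cons_lenlex_iff min_def less_min_leaf_notin)
    moreover have "path_less ?U2 T4" "path_less ?U3 T4" "path_less ?U4 T4"
      using True T four_disjoint
      by (intro path_lessI[where l = "min_leaf P"]; auto simp: Cons_lenlex_iff min_def less_min_leaf_notin)+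
    ultimately show ?thesis by blast
  next
    case False
    then show ?thesis
      using perms3_lex[OF xyz(1)] T four_disjoint
      by (intro conjI; intro path_lessI[where l = "min_leaf A"]) (auto simp: Cons_lenlex_iff min_def less_min_leaf_notin)
  qed
  then show "lower ?U1 T4" "lower ?U2 T4" "lower ?U3 T4" "lower ?U4 T4"
    using T four_disjoint by (auto intro!: lower4I[OF xyz(1)] simp: ac_simps)
qed

text \<open>Here the path of \<open>A\<close> is shorter, so the colours do not matter.\<close>

lemma lower_short:
  assumes xyz: "(x, y, z) \<in> perms3"
  shows "lower (Br z (Br y A (Br x P Q)) R) T4" (is "lower ?U1 _")
    and "lower (Br z (Br y A (Br x P R)) Q) T4" (is "lower ?U2 _")
    and "lower (Br z (Br y A P) (Br x Q R)) T4" (is "lower ?U3 _")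
    and "lower (Br z A (Br y (Br x P Q) R)) T4" (is "lower ?U4 _")
proof -
  have "path_less ?U1 T4 \<and> path_less ?U2 T4 \<and> path_less ?U3 T4 \<and> path_less ?U4 T4"
    using T four_disjoint
    by (intro conjI; intro path_lessI[where l = "min_leaf A"]) (auto simp: Cons_lenlex_iff min_def less_min_leaf_notin)
  then show "lower ?U1 T4" "lower ?U2 T4" "lower ?U3 T4" "lower ?U4 T4"
    using T four_disjoint by (auto intro!: lower4I[OF xyz(1)] simp: ac_simps)
qed

lemma confluence_overlap:
  "compat_rel (sgl (Br h A P)) (sgl Q) (sgl R) i j - fbr j (compat_rel (sgl A) (sgl P) (sgl Q) h i) (sgl R)
    \<in> (low T4 :: (nat, 'c::field) free_magma_alg set)"
proof -
  let ?a = "sgl A" and ?p = "sgl P" and ?q = "sgl Q" and ?r = "sgl R"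
  let ?P12 = "{(x, y, z)\<in>perms3. x \<le> y}" and ?P23 = "{(x, y, z)\<in>perms3. y \<le> z}"
  have fin: "finite ?P12" "finite ?P23"
    by (rule finite_subset[OF _ finite_perms3]; auto)+
  have s12: "(\<Sum>(x, y, z)\<in>perms3. f x y z) = (\<Sum>(x, y, z)\<in>?P12. f x y z + (if x = y then 0 else f y x z))"
    for f :: "nat \<Rightarrow> nat \<Rightarrow> nat \<Rightarrow> (nat, 'c) free_magma_alg"
    by (rule sum_sorted_pairs12) (auto intro: perms3_swap)
  have s23: "(\<Sum>(x, y, z)\<in>perms3. f x y z) = (\<Sum>(x, y, z)\<in>?P23. f x y z + (if y = z then 0 else f x z y))"
    for f :: "nat \<Rightarrow> nat \<Rightarrow> nat \<Rightarrow> (nat, 'c) free_magma_alg"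
    by (rule sum_sorted_pairs23) (auto intro: perms3_swap)
  have left: "(\<Sum>(x, y, z)\<in>perms3. fbr z (jacobi_defect b c d x y) e) = (\<Sum>(x, y, z)\<in>?P12. fbr z (compat_rel b c d x y) e)"
    for b c d e :: "(nat, 'c) free_magma_alg"
    unfolding s12 by (rule sum.cong) (auto simp: compat_rel_def fbr_linear)
  have right: "(\<Sum>(x, y, z)\<in>perms3. fbr z e (jacobi_defect b c d x y)) = (\<Sum>(x, y, z)\<in>?P12. fbr z e (compat_rel b c d x y))"
    for b c d e :: "(nat, 'c) free_magma_alg"
    unfolding s12 by (rule sum.cong) (auto simp: compat_rel_def fbr_linear)
  have outer: "(\<Sum>(x, y, z)\<in>perms3. jacobi_defect (b x) (c x) (d x) y z) = (\<Sum>(x, y, z)\<in>?P23. compat_rel (b x) (c x) (d x) y z)"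
    for b c d :: "nat \<Rightarrow> (nat, 'c) free_magma_alg"
    unfolding s23 by (rule sum.cong) (auto simp: compat_rel_def)
  \<comment> \<open>Eight of the ten families of the syzygy. Their leading trees have a shape other
    than that of \<open>T4\<close>, and are below it for every arrangement of colours.\<close>
  let ?X = "- (\<Sum>(x, y, z)\<in>?P12. fbr z (compat_rel ?a ?p ?r x y) ?q) + (\<Sum>(x, y, z)\<in>?P12. fbr z (compat_rel ?a ?q ?r x y) ?p)
     + (\<Sum>(x, y, z)\<in>?P12. fbr z ?a (compat_rel ?p ?q ?r x y))
     + (\<Sum>(x, y, z)\<in>?P23. compat_rel (fbr x ?a ?q) ?p ?r y z) - (\<Sum>(x, y, z)\<in>?P23. compat_rel (fbr x ?a ?r) ?p ?q y z)
     + (\<Sum>(x, y, z)\<in>?P23. compat_rel ?a (fbr x ?p ?q) ?r y z) - (\<Sum>(x, y, z)\<in>?P23. compat_rel ?a (fbr x ?p ?r) ?q y z)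
     - (\<Sum>(x, y, z)\<in>?P23. compat_rel ?a ?p (fbr x ?q ?r) y z) :: (nat, 'c) free_magma_alg"
  let ?Y12 = "\<Sum>(x, y, z)\<in>?P12. fbr z (compat_rel ?a ?p ?q x y) ?r :: (nat, 'c) free_magma_alg"
  let ?Y23 = "\<Sum>(x, y, z)\<in>?P23. compat_rel (fbr x ?a ?p) ?q ?r y z :: (nat, 'c) free_magma_alg"
  have "(\<Sum>(x, y, z)\<in>perms3. syzygy_remainder ?a ?p ?q ?r x y z - syzygy_remainder ?a ?p ?q ?r y x z) = (0 :: (nat, 'c) free_magma_alg)"
    using sum_swap_invariant[of perms3 "syzygy_remainder ?a ?p ?q ?r", OF perms3_swap(1)]
    by (simp add: sum_subtractf case_prod_unfold)
  then have *: "?Y12 - ?Y23 + ?X = 0"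
    unfolding syzygy[symmetric] left[symmetric] right[symmetric] outer[symmetric]
    by (simp add: sum.distrib sum_subtractf case_prod_unfold algebra_simps)
  have X_low: "?X \<in> low T4"
    by (intro low_add low_diff low_uminus low_sum)
       (auto simp: fbr_sgl min_leaf_le T four_disjoint simp del: rels.simps
          intro!: lowI[OF rels_left[OF rels_base]] lowI[OF rels_right[OF rels_base]] lowI[OF rels_base]
            lower_short lower_long)
  \<comment> \<open>Since \<open>h <= i <= j\<close>, the two relations to be compared occur in the
    remaining families; the rest of these has the shape of \<open>T4\<close> with smaller
    colours.\<close>
  have mem: "(h, i, j) \<in> ?P12" "(h, i, j) \<in> ?P23"
    using T by (auto simp: perms3_def)
  have Y12: "?Y12 = fbr j (compat_rel ?a ?p ?q h i) ?r + (\<Sum>(x, y, z)\<in>?P12 - {(h, i, j)}. fbr z (compat_rel ?a ?p ?q x y) ?r)"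
    by (subst sum.remove[OF fin(1) mem(1)]) simp
  have Y23: "?Y23 = compat_rel (fbr h ?a ?p) ?q ?r i j + (\<Sum>(x, y, z)\<in>?P23 - {(h, i, j)}. compat_rel (fbr x ?a ?p) ?q ?r y z)"
    by (subst sum.remove[OF fin(2) mem(2)]) simp
  have Z12: "(\<Sum>(x, y, z)\<in>?P12 - {(h, i, j)}. fbr z (compat_rel ?a ?p ?q x y) ?r) \<in> low T4"
    by (intro low_sum) (auto simp: T simp del: rels.simps
        intro!: lowI[OF rels_left[OF rels_base]] lower_colours)
  have Z23: "(\<Sum>(x, y, z)\<in>?P23 - {(h, i, j)}. compat_rel (fbr x ?a ?p) ?q ?r y z) \<in> low T4"
    by (intro low_sum) (auto simp: T fbr_sgl simp del: rels.simps intro!: lowI[OF rels_base] lower_colours)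
  show ?thesis
    unfolding fbr_sgl[symmetric] leading_difference[OF * Y12 Y23]
    by (intro low_add low_diff X_low Z12 Z23)
qed

end

text \<open>Two positions in the same subtree are handled by induction, and positions in different
  subtrees commute. A root position meets either a relation inside \<open>A\<close>,
  \<open>B\<close> or \<open>U\<close>, or the overlap at the adjacent node. At the root itself
  \<open>T\<close> determines the relation.\<close>

theorem confluence:
  assumes "normal T" "f \<in> rels T" "g \<in> rels T"
  shows "f - g \<in> low T"
  using assms
proof (induction T arbitrary: f g)
  case (Br k S U)
  have cases: "(\<exists>f'. f' \<in> rels S \<and> f = fbr k f' (sgl U)) \<or> (\<exists>f'. f' \<in> rels U \<and> f = fbr k (sgl S) f') \<or>
     (\<exists>i A B. S = Br i A B \<and> min_leaf B < min_leaf U \<and> i \<le> k \<and> f = compat_rel (sgl A) (sgl B) (sgl U) i k)"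
    if "f \<in> rels (Br k S U)" for f :: "(nat, 'a) free_magma_alg"
    using that by auto
  have symm: "f - g \<in> low (Br k S U)" if "g - f \<in> low (Br k S U)" for f g :: "(nat, 'a) free_magma_alg"
    using low_uminus[OF that] by simp
  have base: "compat_rel (sgl A) (sgl B) (sgl U) i k - g \<in> low (Br k S U)"
    if S: "S = Br i A B" "min_leaf B < min_leaf U" "i \<le> k" and "g \<in> rels (Br k S U)" for i A B and g :: "(nat, 'a) free_magma_alg"
    using cases[OF that(4)]
  proof (elim disjE exE conjE)
    fix f' assume f': "f' \<in> rels S" "g = fbr k f' (sgl U)"
    then consider (left) g' where "g' \<in> rels A" "f' = fbr i g' (sgl B)"
      | (right) g' where "g' \<in> rels B" "f' = fbr i (sgl A) g'"
      | (base) h C D where "A = Br h C D" "min_leaf D < min_leaf B" "h \<le> i" "f' = compat_rel (sgl C) (sgl D) (sgl B) h i"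
      by (auto simp: S)
    then show ?thesis
    proof cases
      case left
      then show ?thesis
        using confluence_left_leaf[of k i A B U g'] Br.prems(1) S f' by simp
    next
      case right
      then show ?thesis
        using confluence_middle_leaf[of k i A B U g'] Br.prems(1) S f' by simp
    next
      case base
      then show ?thesis
        using confluence_overlap[of k i h C D B U] Br.prems(1) S f' by simp
    qed
  next
    fix f' assume "f' \<in> rels U" "g = fbr k (sgl S) f'"
    then show ?thesis
      using confluence_right_leaf[of k i A B U f'] Br.prems(1) S by simp
  next
    fix i' A' B' assume "S = Br i' A' B'" "g = compat_rel (sgl A') (sgl B') (sgl U) i' k"
    then show ?thesis using S by (simp add: low_0)
  qed
  from cases[OF Br.prems(2)] show ?case
  proof (elim disjE exE conjE)
    fix f' assume f': "f' \<in> rels S" "f = fbr k f' (sgl U)"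
    from cases[OF Br.prems(3)] show ?thesis
    proof (elim disjE exE conjE)
      fix g' assume "g' \<in> rels S" "g = fbr k g' (sgl U)"
      then show ?thesis
        using low_fbr_left[of "f' - g'" S k U] Br f' by (auto simp: fbr_linear)
    next
      fix g' assume "g' \<in> rels U" "g = fbr k (sgl S) g'"
      then show ?thesis
        using confluence_disjoint[of f' S g' U k] Br.prems f' by simp
    next
      fix i A B assume "S = Br i A B" "min_leaf B < min_leaf U" "i \<le> k" "g = compat_rel (sgl A) (sgl B) (sgl U) i k"
      then show ?thesis
        using symm[OF base] Br.prems(2) by blast
    qed
  next
    fix f' assume f': "f' \<in> rels U" "f = fbr k (sgl S) f'"
    from cases[OF Br.prems(3)] show ?thesis
    proof (elim disjE exE conjE)
      fix g' assume "g' \<in> rels U" "g = fbr k (sgl S) g'"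
      then show ?thesis
        using low_fbr_right[of "f' - g'" U k S] Br f' by (auto simp: fbr_linear)
    next
      fix g' assume "g' \<in> rels S" "g = fbr k g' (sgl U)"
      then show ?thesis
        using symm[OF confluence_disjoint[of g' S f' U k]] Br.prems f' by simp
    next
      fix i A B assume "S = Br i A B" "min_leaf B < min_leaf U" "i \<le> k" "g = compat_rel (sgl A) (sgl B) (sgl U) i k"
      then show ?thesis
        using symm[OF base] Br.prems(2) by blast
    qed
  next
    fix i A B assume "S = Br i A B" "min_leaf B < min_leaf U" "i \<le> k" "f = compat_rel (sgl A) (sgl B) (sgl U) i k"
    then show ?thesis
      using base Br.prems(3) by blast
  qed
qed simp

section \<open>Normal forms\<close>

primrec lyndon :: "nat bword \<Rightarrow> bool" where
  "lyndon (Gen a) = True"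
| "lyndon (Br k S U) = (lyndon S \<and> lyndon U \<and> (\<forall>i A B. S = Br i A B \<longrightarrow> min_leaf U < min_leaf B \<or> k < i))"

lemma rels_empty_iff: "normal T \<Longrightarrow> rels T = {} \<longleftrightarrow> lyndon T"
proof (induction T)
  case (Br k S U)
  have "min_leaf B \<noteq> min_leaf U" if "S = Br i A B" for i A B
    using Br.prems that min_leaf_neq[of B U] by auto
  with Br show ?case by (auto simp: not_less)
qed simp

text \<open>An arbitrary choice suffices: by confluence any other relation with the same leading
  tree leads to the same normal form.\<close>

definition pick :: "nat bword \<Rightarrow> (nat, 'k::field) free_magma_alg" where
  "pick T = (SOME f. f \<in> rels T)"

lemma pick_in:
  fixes T :: "nat bword"
  assumes "rels T \<noteq> ({} :: (nat, 'k::field) free_magma_alg set)"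
  shows "pick T \<in> (rels T :: (nat, 'k) free_magma_alg set)"
  using assms unfolding pick_def by (simp add: some_in_eq)

lemma keys_pick_lower:
  assumes "normal T" "\<not> lyndon T" "U \<in> Poly_Mapping.keys (pick T - sgl T :: (nat, 'k::field) free_magma_alg)"
  shows "lower U T"
proof -
  have "pick T - sgl T \<in> (lows T :: (nat, 'k) free_magma_alg set)"
    using assms pick_in[of T] rels_tail[of T "pick T"] rels_empty_iff[of T] by auto
  with assms(3) show ?thesis
    by (auto simp: lows_def)
qed

function nf :: "nat bword \<Rightarrow> (nat, 'k::field) free_magma_alg" where
  "nf T = (if normal T \<and> \<not> lyndon T
     then - (\<Sum>U\<in>Poly_Mapping.keys (pick T - sgl T :: (nat, 'k) free_magma_alg).
        smul (Poly_Mapping.lookup (pick T - sgl T) U) (nf U))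
     else sgl T)"
  by pat_completeness auto
termination
proof (relation "{(S, T). path_less S T}")
  show "wf {(S, T). path_less S T}" by (rule wf_path_less)
  fix T U
  assume "normal T \<and> \<not> lyndon T" "U \<in> Poly_Mapping.keys (pick T - sgl T :: (nat, 'k::field) free_magma_alg)"
  then show "(U, T) \<in> {(S, T). path_less S T}"
    using keys_pick_lower[of T U] by (auto simp: lower_def)
qed

declare nf.simps [simp del]

lemma nf_lyndon: "lyndon T \<Longrightarrow> nf T = sgl T"
  by (simp add: nf.simps)

lemma nf_pick: "normal T \<Longrightarrow> \<not> lyndon T \<Longrightarrow> lext nf (pick T) = 0"
  using lext_add[of nf "pick T - sgl T" "sgl T"]
  by (simp add: nf.simps[of T]) (simp add: lext_def)

text \<open>The recursion for \<open>nf\<close> is made to annihilate \<open>pick T\<close>. By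
  confluence \<open>f\<close> differs from it by an element of \<open>low T\<close>, which the
  induction hypothesis annihilates.\<close>

lemma nf_rels:
  fixes f :: "(nat, 'k::field) free_magma_alg"
  assumes "normal T" "f \<in> rels T"
  shows "lext nf f = 0"
  using wf_path_less assms
proof (induction T arbitrary: f rule: wf_induct_rule)
  case (less T)
  have low: "lext nf h = 0" if "h \<in> low T" for h :: "(nat, 'k) free_magma_alg"
    using that
    by (induction rule: low_induct) (auto simp: lext_linear lext_smul lower_def less.IH)
  have ne: "rels T \<noteq> ({} :: (nat, 'k) free_magma_alg set)"
    using less.prems by auto
  have "lext nf (f - pick T) = 0"
    by (intro low confluence less.prems pick_in ne)
  moreover have "lext nf (pick T :: (nat, 'k) free_magma_alg) = 0"
    using ne rels_empty_iff[OF less.prems(1)] by (intro nf_pick less.prems(1)) blast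
  ultimately show ?case
    by (simp add: lext_linear)
qed

section \<open>Normalization of bracketed words\<close>

text \<open>Antisymmetry makes a bracketed word with distinct leaves equal to plus or minus a normal tree;
  words with a repeated leaf may be sent to \<open>0\<close>, because the relations are multihomogeneous.\<close>

primrec nroot :: "nat bword \<Rightarrow> (nat, 'k::field) free_magma_alg" where
  "nroot (Gen a) = 0"
| "nroot (Br j s t) = (if set_bword s \<inter> set_bword t = {}
     then if min_leaf s < min_leaf t then sgl (Br j s t) else - sgl (Br j t s) else 0)"

text \<open>On the span of normal trees this is an antisymmetric bracket; brackets of trees with a
  common leaf vanish.\<close>

definition nbr :: "nat \<Rightarrow> (nat, 'k::field) free_magma_alg \<Rightarrow> (nat, 'k) free_magma_alg
    \<Rightarrow> (nat, 'k) free_magma_alg" where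
  "nbr j p q = lext nroot (fbr j p q)"

lemma nbr_linear:
  "nbr j (p + p') q = nbr j p q + nbr j p' q" "nbr j p (q + q') = nbr j p q + nbr j p q'"
  "nbr j (- p) q = - nbr j p q" "nbr j p (- q) = - nbr j p q"
  "nbr j (smul c p) q = smul c (nbr j p q)" "nbr j p (smul c q) = smul c (nbr j p q)"
  "nbr j 0 q = 0" "nbr j p 0 = 0"
  by (simp_all add: nbr_def fbr_linear fbr_smul_left fbr_smul_right lext_linear lext_smul)

lemma nbr_sgl: "nbr j (sgl s) (sgl t) = nroot (Br j s t)"
  by (simp add: nbr_def fbr_sgl del: nroot.simps)

lemma linear_induct_UNIV [case_names zero add smul sgl]:
  assumes "P 0" "\<And>p q. P p \<Longrightarrow> P q \<Longrightarrow> P (p + q)" "\<And>c p. P p \<Longrightarrow> P (smul c p)"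
    "\<And>t. P (sgl t)"
  shows "P p"
  by (rule linear_induct[where Q = "\<lambda>_. True"]) (use assms in auto)

lemma nbr_antisym: "nbr j p q = - nbr j q p"
proof (induction p rule: linear_induct_UNIV)
  case (sgl s)
  show ?case
  proof (induction q rule: linear_induct_UNIV)
    case (sgl t)
    show ?case using min_leaf_neq[of s t] by (auto simp: nbr_sgl)
  qed (simp_all add: nbr_linear)
qed (simp_all add: nbr_linear magma.scale_minus_right)

primrec normal_word :: "nat bword \<Rightarrow> (nat, 'k::field) free_magma_alg" where
  "normal_word (Gen a) = sgl (Gen a)"
| "normal_word (Br j s t) = nbr j (normal_word s) (normal_word t)"

text \<open>Being a homomorphism turns every closure rule of \<open>compat_ideal\<close> into a
  statement about \<open>nbr\<close>.\<close>

lemma normal_word_fbr: "lext normal_word (fbr j p q) = nbr j (lext normal_word p) (lext normal_word q)"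
proof (induction p rule: linear_induct_UNIV)
  case (sgl s)
  show ?case
    by (induction q rule: linear_induct_UNIV)
      (simp_all add: nbr_linear fbr_linear fbr_smul_right fbr_sgl lext_linear lext_smul)
qed (simp_all add: nbr_linear fbr_linear fbr_smul_left lext_linear lext_smul)

lemma normal_word_normal: "normal T \<Longrightarrow> normal_word T = sgl T"
  by (induction T) (auto simp: nbr_sgl)

definition normals :: "(nat, 'k::field) free_magma_alg set" where
  "normals = {p. \<forall>t\<in>Poly_Mapping.keys p. normal t}"

lemma normals_intros:
  "0 \<in> normals" "normal t \<Longrightarrow> sgl t \<in> normals"
  "p \<in> normals \<Longrightarrow> q \<in> normals \<Longrightarrow> p + q \<in> normals"
  "p \<in> normals \<Longrightarrow> - p \<in> normals" "p \<in> normals \<Longrightarrow> smul c p \<in> normals"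
  using keys_add[of p q] by (auto simp: normals_def in_keys_iff)

lemma normals_induct [consumes 1, case_names zero add smul sgl]:
  assumes "p \<in> normals" "P 0" "\<And>p q. P p \<Longrightarrow> P q \<Longrightarrow> P (p + q)" "\<And>c p. P p \<Longrightarrow> P (smul c p)"
    "\<And>t. normal t \<Longrightarrow> P (sgl t)"
  shows "P p"
  by (rule linear_induct[where Q = normal]) (use assms in \<open>auto simp: normals_def\<close>)

lemma nbr_normals: "p \<in> normals \<Longrightarrow> q \<in> normals \<Longrightarrow> nbr j p q \<in> normals"
proof (induction p rule: normals_induct)
  case (sgl s)
  from sgl(2,1) show ?case
  proof (induction q rule: normals_induct)
    case (sgl t)
    then show ?case using min_leaf_neq[of s t] by (auto simp: nbr_sgl intro!: normals_intros)
  qed (auto simp: nbr_linear intro: normals_intros)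
qed (auto simp: nbr_linear intro: normals_intros)

lemma normal_word_normals: "lext normal_word p \<in> normals"
proof (induction p rule: linear_induct_UNIV)
  case (sgl t)
  show ?case by (induction t) (auto intro: normals_intros nbr_normals)
qed (auto simp: lext_linear lext_smul intro: normals_intros)

definition relspan :: "(nat, 'k::field) free_magma_alg set" where
  "relspan = magma.span (\<Union>T\<in>{T. normal T}. rels T)"

lemma relspan_intros:
  "0 \<in> relspan" "p \<in> relspan \<Longrightarrow> q \<in> relspan \<Longrightarrow> p + q \<in> relspan"
  "p \<in> relspan \<Longrightarrow> - p \<in> relspan" "p \<in> relspan \<Longrightarrow> smul c p \<in> relspan"
  "f \<in> rels T \<Longrightarrow> normal T \<Longrightarrow> f \<in> relspan"
  unfolding relspan_def
  by (auto intro: magma.span_zero magma.span_add magma.span_neg magma.span_scale magma.span_base)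

lemma relspan_induct [consumes 1, case_names zero step]:
  assumes "p \<in> relspan" "P 0" "\<And>c f p T. f \<in> rels T \<Longrightarrow> normal T \<Longrightarrow> P p \<Longrightarrow> P (smul c f + p)"
  shows "P p"
  using assms(1) unfolding relspan_def
  by (induction rule: magma.span_induct_alt) (auto intro: assms)

lemma nf_relspan: "f \<in> relspan \<Longrightarrow> lext nf f = 0"
  by (induction rule: relspan_induct) (auto simp: lext_linear lext_smul nf_rels)

text \<open>The tree \<open>T\<close> only supplies the common leaf set of the words in
  \<open>f\<close>; this set decides the sign, so one sign serves all terms.\<close>

lemma nbr_sgl_left:
  assumes "\<And>U. U \<in> Poly_Mapping.keys f \<Longrightarrow> set_bword U = set_bword T"
  shows "nbr j (sgl S) f = (if set_bword S \<inter> set_bword T = {}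
    then if min_leaf S < min_leaf T then fbr j (sgl S) f else - fbr j f (sgl S) else 0)"
  by (rule linear_induct[where p = f and Q = "\<lambda>U. set_bword U = set_bword T"])
    (auto simp: assms nbr_linear nbr_sgl fbr_linear fbr_sgl fbr_smul_left fbr_smul_right
      magma.scale_minus_right dest: min_leaf_cong)

lemma keys_rels:
  assumes "normal T" "f \<in> rels T" "U \<in> Poly_Mapping.keys f"
  shows "set_bword U = set_bword T"
proof (cases "U = T")
  case False
  then have "U \<in> Poly_Mapping.keys (f - sgl T)"
    using assms(3) by (auto simp: in_keys_iff lookup_minus lookup_single when_def)
  then show ?thesis
    using rels_tail[OF assms(1,2)] by (auto simp: lows_def lower_def path_less_set)
qed simp

text \<open>Without a common leaf, the bracket is up to sign a relation of a larger normal tree,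
  with \<open>S\<close> on the side dictated by the smallest leaves.\<close>

lemma nbr_relspan_sgl: "f \<in> relspan \<Longrightarrow> normal S \<Longrightarrow> nbr j (sgl S) f \<in> relspan"
proof (induction f rule: relspan_induct)
  case (step c f p T)
  have "nbr j (sgl S) f \<in> relspan"
  proof (cases "set_bword S \<inter> set_bword T = {}")
    case True
    then show ?thesis
      using step min_leaf_neq[OF True]
      by (subst nbr_sgl_left[OF keys_rels[OF step(2,1)]])
        (auto simp del: rels.simps
          intro!: relspan_intros(3) relspan_intros(5)[OF rels_right] relspan_intros(5)[OF rels_left])
  next
    case False
    then show ?thesis
      by (subst nbr_sgl_left[OF keys_rels[OF step(2,1)]]) (auto intro: relspan_intros)
  qed
  then show ?case
    using step by (auto simp: nbr_linear intro: relspan_intros)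
qed (simp add: nbr_linear relspan_intros)

lemma nbr_relspan: "f \<in> relspan \<Longrightarrow> p \<in> normals \<Longrightarrow> nbr j p f \<in> relspan"
  by (rotate_tac, induction p rule: normals_induct)
    (auto simp: nbr_linear nbr_relspan_sgl intro: relspan_intros)

text \<open>For \<open>i = j\<close>, \<open>compat_sum\<close> is the Jacobi sum.\<close>

definition cyclic_sum :: "nat \<Rightarrow> nat \<Rightarrow> (nat, 'k::field) free_magma_alg \<Rightarrow> (nat, 'k) free_magma_alg
    \<Rightarrow> (nat, 'k) free_magma_alg \<Rightarrow> (nat, 'k) free_magma_alg" where
  "cyclic_sum i j x y z = nbr i x (nbr j y z) + nbr i z (nbr j x y) + nbr i y (nbr j z x)"

definition compat_sum :: "nat \<Rightarrow> nat \<Rightarrow> (nat, 'k::field) free_magma_alg \<Rightarrow> (nat, 'k) free_magma_alg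
    \<Rightarrow> (nat, 'k) free_magma_alg \<Rightarrow> (nat, 'k) free_magma_alg" where
  "compat_sum i j x y z = cyclic_sum i j x y z + (if i = j then 0 else cyclic_sum j i x y z)"

lemma cyclic_sum_rotate: "cyclic_sum i j y z x = cyclic_sum i j x y z"
  by (simp add: cyclic_sum_def)

lemma cyclic_sum_flip: "cyclic_sum i j x z y = - cyclic_sum i j x y z"
  using nbr_antisym[of j z y] nbr_antisym[of j y x] nbr_antisym[of j x z]
  by (simp add: cyclic_sum_def nbr_linear)

lemma compat_sum_rotate: "compat_sum i j y z x = compat_sum i j x y z"
  by (simp only: compat_sum_def cyclic_sum_rotate)

lemma compat_sum_flip: "compat_sum i j x z y = - compat_sum i j x y z"
  by (auto simp: compat_sum_def cyclic_sum_flip[of _ _ x y z])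

lemma cyclic_sum_sorted:
  assumes "normal (Br j (Br i A B) C)" "min_leaf B < min_leaf C"
  shows "cyclic_sum i j (sgl A) (sgl B) (sgl C) = - jacobi_defect (sgl A) (sgl B) (sgl C) j i"
proof -
  have "set_bword A \<inter> set_bword B = {}" "set_bword A \<inter> set_bword C = {}" "set_bword B \<inter> set_bword C = {}"
    "min_leaf A < min_leaf B" "min_leaf A < min_leaf C"
    using assms by auto
  with assms(2) show ?thesis
    by (simp add: cyclic_sum_def jacobi_defect_def nbr_linear nbr_sgl fbr_sgl Int_Un_distrib Int_Un_distrib2 Int_commute)
qed

lemma compat_sum_sorted:
  assumes "normal (Br j (Br i A B) C)" "min_leaf B < min_leaf C"
  shows "compat_sum i j (sgl A) (sgl B) (sgl C) \<in> relspan"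
proof -
  \<comment> \<open>\<open>rels\<close> is indexed with the smaller colour inside;
    \<open>compat_rel\<close> is symmetric in the colours.\<close>
  have eq: "compat_sum i j (sgl A) (sgl B) (sgl C) = - compat_rel (sgl A) (sgl B) (sgl C) (min i j) (max i j)"
    using assms cyclic_sum_sorted[OF assms] cyclic_sum_sorted[of i j A B C]
    by (auto simp: compat_sum_def compat_rel_def min_def max_def)
  have "compat_rel (sgl A) (sgl B) (sgl C) (min i j) (max i j) \<in> rels (Br (max i j) (Br (min i j) A B) C)"
    by (rule rels_base[OF assms(2)]) simp
  then have "compat_rel (sgl A) (sgl B) (sgl C) (min i j) (max i j) \<in> relspan"
    by (rule relspan_intros(5)) (use assms in auto)
  then show ?thesis
    unfolding eq by (rule relspan_intros(3))
qed

text \<open>A common leaf kills every term. Otherwise rotations and a flip sort the three smallest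
  leaves.\<close>

lemma compat_sum_sgl:
  assumes "normal A" "normal B" "normal C"
  shows "compat_sum i j (sgl A) (sgl B) (sgl C) \<in> (relspan :: (nat, 'k::field) free_magma_alg set)"
proof (cases "set_bword A \<inter> set_bword B = {} \<and> set_bword A \<inter> set_bword C = {} \<and> set_bword B \<inter> set_bword C = {}")
  case False
  then have "cyclic_sum i j (sgl A) (sgl B) (sgl C) = (0 :: (nat, 'k) free_magma_alg)" for i j
    by (auto simp: cyclic_sum_def nbr_sgl nbr_linear Int_Un_distrib Int_Un_distrib2 Int_commute)
  then show ?thesis by (simp add: compat_sum_def relspan_intros)
next
  case True
  have sorted: "compat_sum i j (sgl A) (sgl B) (sgl C) \<in> (relspan :: (nat, 'k) free_magma_alg set)"
    if "set_bword A \<inter> set_bword B = {} \<and> set_bword A \<inter> set_bword C = {} \<and> set_bword B \<inter> set_bword C = {}"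
      "normal A" "normal B" "normal C" "min_leaf A < min_leaf B" "min_leaf B < min_leaf C" for A B C
    using that by (intro compat_sum_sorted) auto
  let ?a = "sgl A :: (nat, 'k) free_magma_alg" and ?b = "sgl B :: (nat, 'k) free_magma_alg"
    and ?c = "sgl C :: (nat, 'k) free_magma_alg"
  have flip: "compat_sum i j ?a ?b ?c \<in> relspan" if "compat_sum i j ?a ?c ?b \<in> relspan"
    using relspan_intros(3)[OF that] by (simp add: compat_sum_flip[of i j ?a ?b ?c])
  have "min_leaf A \<noteq> min_leaf B" "min_leaf A \<noteq> min_leaf C" "min_leaf B \<noteq> min_leaf C"
    using True min_leaf_neq by blast+
  then consider "min_leaf A < min_leaf B \<and> min_leaf B < min_leaf C" | "min_leaf B < min_leaf C \<and> min_leaf C < min_leaf A" | "min_leaf C < min_leaf A \<and> min_leaf A < min_leaf B"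
    | "min_leaf A < min_leaf C \<and> min_leaf C < min_leaf B" | "min_leaf C < min_leaf B \<and> min_leaf B < min_leaf A" | "min_leaf B < min_leaf A \<and> min_leaf A < min_leaf C"
    by linarith
  then show ?thesis
  proof cases
    case 1
    then show ?thesis using True assms by (intro sorted) auto
  next
    case 2
    then have "compat_sum i j ?b ?c ?a \<in> relspan" using True assms by (intro sorted) auto
    then show ?thesis by (simp only: compat_sum_rotate[of i j ?b ?c ?a])
  next
    case 3
    then have "compat_sum i j ?c ?a ?b \<in> relspan" using True assms by (intro sorted) auto
    then show ?thesis by (simp only: compat_sum_rotate[of i j ?a ?b ?c] compat_sum_rotate[of i j ?c ?a ?b])
  next
    case 4
    then have "compat_sum i j ?a ?c ?b \<in> relspan" using True assms by (intro sorted) auto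
    then show ?thesis by (rule flip)
  next
    case 5
    then have "compat_sum i j ?c ?b ?a \<in> relspan" using True assms by (intro sorted) auto
    then show ?thesis by (intro flip) (simp only: compat_sum_rotate[of i j ?a ?c ?b] compat_sum_rotate[of i j ?b ?a ?c])
  next
    case 6
    then have "compat_sum i j ?b ?a ?c \<in> relspan" using True assms by (intro sorted) auto
    then show ?thesis by (intro flip) (simp only: compat_sum_rotate[of i j ?a ?c ?b])
  qed
qed

lemma compat_sum_linear:
  "compat_sum i j (x + x') y z = compat_sum i j x y z + compat_sum i j x' y z"
  "compat_sum i j x (y + y') z = compat_sum i j x y z + compat_sum i j x y' z"
  "compat_sum i j x y (z + z') = compat_sum i j x y z + compat_sum i j x y z'"
  "compat_sum i j (smul c x) y z = smul c (compat_sum i j x y z)"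
  "compat_sum i j x (smul c y) z = smul c (compat_sum i j x y z)"
  "compat_sum i j x y (smul c z) = smul c (compat_sum i j x y z)"
  "compat_sum i j 0 y z = 0" "compat_sum i j x 0 z = 0" "compat_sum i j x y 0 = 0"
  by (simp_all add: compat_sum_def cyclic_sum_def nbr_linear smul_module)

lemma compat_sum_relspan:
  assumes "x \<in> normals" "y \<in> normals" "z \<in> normals"
  shows "compat_sum i j x y z \<in> relspan"
  using assms
proof (induction x rule: normals_induct)
  case A: (sgl A)
  from A(2,3,1) show ?case
  proof (induction y rule: normals_induct)
    case B: (sgl B)
    from B(2,3,1) show ?case
      by (induction z rule: normals_induct) (auto simp: compat_sum_linear compat_sum_sgl intro: relspan_intros)
  qed (auto simp: compat_sum_linear intro: relspan_intros)
qed (auto simp: compat_sum_linear intro: relspan_intros)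

lemma normal_word_compat_ideal: "p \<in> compat_ideal UNIV \<Longrightarrow> lext normal_word p \<in> relspan"
proof (induction rule: compat_ideal.induct)
  case (left p x j)
  then show ?case by (simp add: normal_word_fbr nbr_relspan normal_word_normals)
next
  case (right p x j)
  then show ?case
    using nbr_antisym[of j "lext normal_word p" "lext normal_word x"]
    by (simp add: normal_word_fbr nbr_relspan normal_word_normals relspan_intros)
next
  case (antisym x y j)
  then show ?case
    using nbr_antisym[of j "lext normal_word x" "lext normal_word y"]
    by (simp add: normal_word_fbr lext_linear relspan_intros)
next
  case (jacobi x y z j)
  show ?case
    using compat_sum_relspan[OF normal_word_normals[of x] normal_word_normals[of y] normal_word_normals[of z], of j j]
    by (simp add: normal_word_fbr lext_linear compat_sum_def cyclic_sum_def)
next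
  case (compat x y z i j)
  then show ?case
    using compat_sum_relspan[OF normal_word_normals[of x] normal_word_normals[of y] normal_word_normals[of z], of i j]
    by (simp add: normal_word_fbr lext_linear compat_sum_def cyclic_sum_def ac_simps)
qed (auto simp: lext_linear lext_smul intro: relspan_intros)

lemma lext_sgl_id: "(\<And>t. t \<in> Poly_Mapping.keys p \<Longrightarrow> \<phi> t = sgl t) \<Longrightarrow> lext \<phi> p = p"
  unfolding lext_def using sgl_expansion[of p] by simp

text \<open>\<open>normal_word\<close> carries the ideal into \<open>relspan\<close>, which
  \<open>nf\<close> annihilates, yet both maps fix normal Lyndon trees.\<close>

lemma lyndon_independent:
  assumes "p \<in> compat_ideal UNIV" "\<And>t. t \<in> Poly_Mapping.keys p \<Longrightarrow> normal t \<and> lyndon t"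
  shows "p = 0"
proof -
  have "lext normal_word p = p" "lext nf p = p"
    using assms(2) by (auto intro: lext_sgl_id normal_word_normal nf_lyndon)
  with nf_relspan[OF normal_word_compat_ideal[OF assms(1)]] show ?thesis by simp
qed

section \<open>Dimension\<close>

lemma lie_class_linear:
  "lie_class (p + q) = lie_class p + lie_class q" "lie_class (smul c p) = lie_scale c (lie_class p)"
  "lie_class (0 :: ('a, 'k::field) free_magma_alg) = 0" "lie_class (- p) = - lie_class p"
  by (simp_all add: plus_free_lie.abs_eq lie_scale.abs_eq zero_free_lie_def uminus_free_lie.abs_eq)

lemma lie_class_sum: "lie_class (sum f A) = (\<Sum>a\<in>A. lie_class (f a))"
  by (induction A rule: infinite_finite_induct) (simp_all add: lie_class_linear)

lemma lie_class_eq_0: "lie_class p = 0 \<longleftrightarrow> p \<in> compat_ideal UNIV"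
  by (simp add: zero_free_lie_def free_lie.abs_eq_iff)

lemma lie_eval_sgl: "lie_eval t = lie_class (sgl t)"
  by (induction t) (simp_all add: lie_gen_def lie_bracket.abs_eq fbr_sgl)

lemma lie_class_lows:
  assumes "p \<in> lows T" "\<And>U. lower U T \<Longrightarrow> lie_eval U \<in> free_lie.span S"
  shows "lie_class p \<in> free_lie.span S"
  using assms
  by (induction rule: lows_induct)
    (auto simp: lie_class_linear lie_eval_sgl intro: free_lie.span_zero free_lie.span_add free_lie.span_scale)

text \<open>Three instances of antisymmetry turn the defect into minus the cyclic Jacobi
  sum.\<close>

lemma jacobi_defect_antisym:
  fixes a b c :: "('a, 'k::field) free_magma_alg"
  shows "jacobi_defect a b c x y + (fbr y a (fbr x b c) + fbr y c (fbr x a b) + fbr y b (fbr x c a)) \<in> compat_ideal UNIV"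
proof -
  let ?I = "compat_ideal UNIV :: ('a, 'k) free_magma_alg set"
  have 1: "fbr y (fbr x a b) c + fbr y c (fbr x a b) \<in> ?I"
    and 2: "fbr y (fbr x a c) b + fbr y b (fbr x a c) \<in> ?I"
    and 3: "fbr y b (fbr x c a + fbr x a c) \<in> ?I"
    by (intro compat_ideal.intros free_magma_on_UNIV)+
  have "fbr y (fbr x a b) c + fbr y c (fbr x a b) + fbr y b (fbr x c a + fbr x a c)
      - (fbr y (fbr x a c) b + fbr y b (fbr x a c)) \<in> ?I"
    by (rule compat_ideal_diff[OF compat_ideal.add[OF 1 3] 2])
  then show ?thesis
    by (simp add: jacobi_defect_def fbr_linear algebra_simps)
qed

lemma compat_rel_compat_ideal: "compat_rel a b c i j \<in> compat_ideal UNIV"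
proof (cases "i = j")
  case True
  have "fbr j a (fbr j b c) + fbr j c (fbr j a b) + fbr j b (fbr j c a) \<in> compat_ideal UNIV"
    by (intro compat_ideal.jacobi free_magma_on_UNIV)
  from compat_ideal_diff[OF jacobi_defect_antisym[of a b c j j] this] show ?thesis
    by (simp add: compat_rel_def True)
next
  case False
  have "fbr i a (fbr j b c) + fbr i c (fbr j a b) + fbr i b (fbr j c a) +
      fbr j a (fbr i b c) + fbr j c (fbr i a b) + fbr j b (fbr i c a) \<in> compat_ideal UNIV"
    by (intro compat_ideal.compat free_magma_on_UNIV False)
  from compat_ideal_diff[OF compat_ideal.add[OF jacobi_defect_antisym[of a b c i j] jacobi_defect_antisym[of a b c j i]] this]
  show ?thesis
    by (simp add: compat_rel_def False algebra_simps)
qed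

lemma rels_compat_ideal: "f \<in> rels T \<Longrightarrow> f \<in> compat_ideal UNIV"
  by (induction T arbitrary: f) (auto intro: compat_ideal.intros compat_rel_compat_ideal)

definition lyndon_trees :: "nat set \<Rightarrow> (nat \<Rightarrow>\<^sub>0 nat) \<Rightarrow> nat bword set" where
  "lyndon_trees X \<mu> = {T. normal T \<and> lyndon T \<and> set_bword T = X \<and> wt T = \<mu>}"

text \<open>No confluence here: any one relation expresses a reducible tree by smaller trees with
  the same leaves and colours.\<close>

lemma normal_in_span:
  "normal T \<Longrightarrow> (lie_eval T :: (nat, 'k::field) free_lie)
    \<in> free_lie.span (lie_eval ` lyndon_trees (set_bword T) (wt T))"
proof (induction T rule: wf_induct_rule[OF wf_path_less])
  case (1 T)
  show ?case
  proof (cases "lyndon T")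
    case True
    with 1 show ?thesis
      by (intro free_lie.span_base imageI) (simp add: lyndon_trees_def)
  next
    case False
    then obtain f :: "(nat, 'k) free_magma_alg" where f: "f \<in> rels T"
      using rels_empty_iff[OF 1(2)] by blast
    have "lie_class (f - sgl T) \<in> free_lie.span (lie_eval ` lyndon_trees (set_bword T) (wt T))"
    proof (rule lie_class_lows[OF rels_tail[OF 1(2) f]])
      fix U assume U: "lower U T"
      then show "(lie_eval U :: (nat, 'k) free_lie) \<in> free_lie.span (lie_eval ` lyndon_trees (set_bword T) (wt T))"
        using 1(1)[of U] path_less_set[of U T] by (simp add: lower_def)
    qed
    moreover have "lie_class (f - sgl T) = - lie_eval T"
      using lie_class_linear(1)[of "f - sgl T" "sgl T"] rels_compat_ideal[OF f]
      by (simp add: lie_eval_sgl lie_class_eq_0[symmetric] eq_neg_iff_add_eq_0)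
    ultimately show ?thesis
      using free_lie.span_neg by fastforce
  qed
qed

lemma lie_bracket_uminus:
  "lie_bracket j (- x) y = - lie_bracket j x y" "lie_bracket j x (- y) = - lie_bracket j x y"
  by (transfer; simp add: fbr_uminus_left fbr_uminus_right compat_ideal.zero)+

lemma lie_eval_normal:
  "distinct (leaves_bword t) \<Longrightarrow> \<exists>T. normal T \<and> set_bword T = set_bword t \<and> wt T = wt t \<and>
    ((lie_eval t :: (nat, 'k::field) free_lie) = lie_eval T \<or> (lie_eval t :: (nat, 'k::field) free_lie) = - lie_eval T)"
proof (induction t)
  case (Gen a)
  then show ?case by (intro exI[of _ "Gen a"]) simp
next
  case (Br j s t)
  have leaves: "set (leaves_bword u) = set_bword u" for u :: "nat bword"
    by (induction u) auto
  from Br obtain S T where ST: "normal S" "set_bword S = set_bword s" "wt S = wt s"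
      "normal T" "set_bword T = set_bword t" "wt T = wt t"
    and S: "(lie_eval s :: (nat, 'k) free_lie) = lie_eval S \<or> (lie_eval s :: (nat, 'k) free_lie) = - lie_eval S"
    and T: "(lie_eval t :: (nat, 'k) free_lie) = lie_eval T \<or> (lie_eval t :: (nat, 'k) free_lie) = - lie_eval T"
    by auto
  have dis: "set_bword S \<inter> set_bword T = {}"
    using Br.prems ST by (auto simp: leaves)
  have eq: "(lie_eval (Br j s t) :: (nat, 'k) free_lie) = lie_eval (Br j S T) \<or>
      (lie_eval (Br j s t) :: (nat, 'k) free_lie) = - lie_eval (Br j S T)"
    using S T by (auto simp: lie_bracket_uminus)
  show ?case
  proof (cases "min_leaf S < min_leaf T")
    case True
    then show ?thesis
      using ST dis eq by (intro exI[of _ "Br j S T"]) auto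
  next
    case False
    have "(lie_eval (Br j S T) :: (nat, 'k) free_lie) = - lie_eval (Br j T S)"
      using lie_bracket_antisym by (simp add: eq_neg_iff_add_eq_0)
    then show ?thesis
      using ST dis eq False min_leaf_neq[OF dis] by (intro exI[of _ "Br j T S"]) (auto simp: ac_simps)
  qed
qed

lemma lookup_wt: "Poly_Mapping.lookup (wt t) j = bracket_count j t"
  by (induction t) (auto simp: lookup_add lookup_single when_def)

lemma wt_eq_iff: "wt t = \<mu> \<longleftrightarrow> (\<forall>j. bracket_count j t = Poly_Mapping.lookup \<mu> j)"
  by (simp add: poly_mapping_eq_iff fun_eq_iff lookup_wt)

lemma normal_bracketed:
  "normal T \<Longrightarrow> distinct (leaves_bword T) \<and> set (leaves_bword T) = set_bword T"
  by (induction T) auto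

lemma Lie_span:
  "(Lie n \<mu> :: (nat, 'k::field) free_lie set) = free_lie.span (lie_eval ` lyndon_trees {1..n} \<mu>)"
proof -
  have leaves: "set (leaves_bword u) = set_bword u" for u :: "nat bword"
    by (induction u) auto
  let ?B = "{t \<in> bracketed_perms n. \<forall>j. bracket_count j t = Poly_Mapping.lookup \<mu> j}"
  have "(lie_eval t :: (nat, 'k) free_lie) \<in> free_lie.span (lie_eval ` lyndon_trees {1..n} \<mu>)" if "t \<in> ?B" for t
  proof -
    have t: "distinct (leaves_bword t)" "set_bword t = {1..n}" "wt t = \<mu>"
      using that by (auto simp: bracketed_perms_def wt_eq_iff leaves)
    from lie_eval_normal[OF t(1), where 'k = 'k] obtain T
      where T: "normal T" "set_bword T = set_bword t" "wt T = wt t"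
      "(lie_eval t :: (nat, 'k) free_lie) = lie_eval T \<or> (lie_eval t :: (nat, 'k) free_lie) = - lie_eval T"
      by blast
    with normal_in_span[OF T(1), where 'k = 'k] t show ?thesis
      by (auto intro: free_lie.span_neg)
  qed
  moreover have "lyndon_trees {1..n} \<mu> \<subseteq> ?B"
    using normal_bracketed by (auto simp: lyndon_trees_def bracketed_perms_def simp flip: wt_eq_iff)
  ultimately show ?thesis
    unfolding Lie_def
    by (intro subset_antisym free_lie.span_minimal free_lie.subspace_span free_lie.span_mono image_mono)
       auto
qed

lemma lyndon_trees_independent_sum:
  assumes "finite F" "F \<subseteq> lyndon_trees X \<mu>" "(\<Sum>T\<in>F. lie_scale (c T) (lie_eval T)) = 0" "S \<in> F"
  shows "c S = 0"
proof -
  let ?p = "\<Sum>T\<in>F. smul (c T) (sgl T)"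
  have lookup: "Poly_Mapping.lookup ?p T = (if T \<in> F then c T else 0)" for T
    using assms(1) by (simp add: smul_single lookup_sum lookup_single when_def)
  have "lie_class ?p = 0"
    using assms(3) by (simp add: lie_class_sum lie_class_linear lie_eval_sgl)
  then have "?p \<in> compat_ideal UNIV"
    by (simp only: lie_class_eq_0)
  then have "?p = 0"
    by (rule lyndon_independent)
      (use assms(2) lookup in \<open>auto simp: in_keys_iff lyndon_trees_def split: if_splits\<close>)
  with lookup[of S] assms(4) show ?thesis by simp
qed

lemma dim_Lie:
  "free_lie.dim (Lie n \<mu> :: (nat, 'k::field) free_lie set) = card (lyndon_trees {1..n} \<mu>)"
proof -
  let ?L = "lyndon_trees {1..n} \<mu>"
  \<comment> \<open>Equal images of distinct \<open>S\<close> and \<open>T\<close> would give a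
    nontrivial relation with coefficients 1 and -1.\<close>
  have inj: "inj_on (lie_eval :: _ \<Rightarrow> (nat, 'k) free_lie) ?L"
  proof (rule inj_onI, rule ccontr)
    fix S T assume ST: "S \<in> ?L" "T \<in> ?L" "(lie_eval S :: (nat, 'k) free_lie) = lie_eval T" "S \<noteq> T"
    have "(\<Sum>U\<in>{S, T}. lie_scale (if U = S then 1 else - 1) (lie_eval U)) = (0 :: (nat, 'k) free_lie)"
      using ST by simp
    from lyndon_trees_independent_sum[OF _ _ this, of "{1..n}" \<mu> S] ST show False by auto
  qed
  have "free_lie.independent (lie_eval ` ?L :: (nat, 'k) free_lie set)"
    unfolding free_lie.dependent_explicit
  proof safe
    fix t u and v :: "(nat, 'k) free_lie"
    assume t: "finite t" "t \<subseteq> lie_eval ` ?L" "(\<Sum>v\<in>t. lie_scale (u v) v) = 0" "v \<in> t" "u v \<noteq> 0"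
    then obtain F where F: "F \<subseteq> ?L" "t = lie_eval ` F"
      by (auto simp: subset_image_iff)
    have injF: "inj_on (lie_eval :: _ \<Rightarrow> (nat, 'k) free_lie) F"
      using inj F(1) by (rule inj_on_subset)
    have "finite F"
      using t(1) F(2) injF finite_imageD by blast
    moreover have "(\<Sum>T\<in>F. lie_scale (u (lie_eval T)) (lie_eval T :: (nat, 'k) free_lie)) = 0"
      using t(3) by (simp add: F(2) sum.reindex[OF injF])
    ultimately show False
      using lyndon_trees_independent_sum[OF _ F(1), of "\<lambda>T. u (lie_eval T)"] t(4,5) F(2) by auto
  qed
  then show ?thesis
    unfolding Lie_span free_lie.dim_span
    using card_image[OF inj] by (simp add: free_lie.dim_eq_card_independent)
qed

section \<open>Lyndon types\<close>

text \<open>The head of the list is the block of the root. A non-Lyndon node has an internal left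
  child, so it joins the block of that child.\<close>

primrec blocks :: "ltree \<Rightarrow> ltree set list" where
  "blocks (Leaf a) = []"
| "blocks (Node l r) = (if is_lyndon (Node l r) then {Node l r} # blocks l
     else insert (Node l r) (hd (blocks l)) # tl (blocks l)) @ blocks r"

primrec sizes :: "ltree \<Rightarrow> nat list" where
  "sizes (Leaf a) = []"
| "sizes (Node l r) = (if is_lyndon (Node l r) then 1 # sizes l
     else Suc (hd (sizes l)) # tl (sizes l)) @ sizes r"

lemma not_lyndon_NodeE:
  assumes "\<not> is_lyndon (Node l r)"
  obtains l1 l2 where "l = Node l1 l2"
  using assms by (cases l) auto

lemma blocks_Node_ne [simp]: "blocks (Node l r) \<noteq> []" "sizes (Node l r) \<noteq> []"
  by simp_all

lemma root_in_hd_blocks: "Node l r \<in> hd (blocks (Node l r))"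
  by simp

lemma not_lyndon_blocksE:
  assumes "\<not> is_lyndon (Node l r)"
  obtains b bs where "blocks l = b # bs" "l \<in> b"
proof -
  obtain l1 l2 where l: "l = Node l1 l2"
    using not_lyndon_NodeE[OF assms] .
  then have "l \<in> hd (blocks l)" "blocks l \<noteq> []"
    using root_in_hd_blocks blocks_Node_ne(1) by blast+
  then show ?thesis
    using that by (cases "blocks l") auto
qed

lemma Union_blocks: "\<Union> (set (blocks t)) = internal_nodes t"
proof (induction t)
  case (Node l r)
  show ?case
  proof (cases "is_lyndon (Node l r)")
    case False
    then obtain b bs where "blocks l = b # bs" "l \<in> b"
      by (rule not_lyndon_blocksE)
    with Node False show ?thesis by auto
  qed (use Node in auto)
qed simp

lemma internal_nodes_size: "x \<in> internal_nodes t \<Longrightarrow> size x \<le> size t"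
  by (induction t) auto

lemma Node_notin_internal: "Node l r \<notin> internal_nodes l" "Node l r \<notin> internal_nodes r"
  using internal_nodes_size[of "Node l r" l] internal_nodes_size[of "Node l r" r] by auto

lemma leaves_ne [simp]: "leaves t \<noteq> []"
  by (induction t) auto

lemma internal_nodes_leaves: "x \<in> internal_nodes t \<Longrightarrow> set (leaves x) \<subseteq> set (leaves t)"
  by (induction t) auto

lemma internal_nodes_disjoint:
  assumes "set (leaves l) \<inter> set (leaves r) = {}"
  shows "internal_nodes l \<inter> internal_nodes r = {}"
proof (rule ccontr)
  assume "internal_nodes l \<inter> internal_nodes r \<noteq> {}"
  then obtain x where "x \<in> internal_nodes l" "x \<in> internal_nodes r"
    by auto
  then have "set (leaves x) \<subseteq> set (leaves l) \<inter> set (leaves r)"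
    using internal_nodes_leaves by blast
  with assms show False by simp
qed

lemma finite_internal_nodes [simp]: "finite (internal_nodes t)"
  by (induction t) auto

lemma finite_blocks: "b \<in> set (blocks t) \<Longrightarrow> finite b"
  using Union_blocks[of t] finite_internal_nodes[of t] by (metis Union_upper finite_subset)

lemma blocks_ne: "b \<in> set (blocks t) \<Longrightarrow> b \<noteq> {}"
proof (induction t arbitrary: b)
  case (Node l r)
  then show ?case
    by (cases "is_lyndon (Node l r)"; cases "blocks l") auto
qed simp

text \<open>Disjointness is stated for list positions: as blocks are nonempty, the list is then
  distinct and the Lyndon type keeps its multiplicities.\<close>

lemma blocks_disjoint:
  "distinct (leaves t) \<Longrightarrow> sorted_wrt (\<lambda>a b. a \<inter> b = {}) (blocks t)"
proof (induction t)
  case (Node l r)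
  have sub: "b \<subseteq> internal_nodes l" if "b \<in> set (blocks l)" for b
    using that Union_blocks[of l] by auto
  have sub': "b \<subseteq> internal_nodes r" if "b \<in> set (blocks r)" for b
    using that Union_blocks[of r] by auto
  have dis: "internal_nodes l \<inter> internal_nodes r = {}"
    using Node.prems by (intro internal_nodes_disjoint) simp
  have cross: "a \<inter> b = {}" if "a \<in> set (blocks l)" "b \<in> set (blocks r)" for a b
    using sub[OF that(1)] sub'[OF that(2)] dis by blast
  have root: "Node l r \<notin> b" if "b \<in> set (blocks l) \<union> set (blocks r)" for b
    using that sub sub' Node_notin_internal by blast
  show ?case
  proof (cases "is_lyndon (Node l r)")
    case True
    then show ?thesis
      using Node cross root by (auto simp: sorted_wrt_append)
  next
    case False
    then obtain b bs where b: "blocks l = b # bs"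
      by (rule not_lyndon_blocksE)
    then show ?thesis
      using Node cross root False by (auto simp: sorted_wrt_append)
  qed
qed simp

lemma map_card_blocks: "map card (blocks t) = sizes t"
proof (induction t)
  case (Node l r)
  show ?case
  proof (cases "is_lyndon (Node l r)")
    case False
    then obtain b bs where b: "blocks l = b # bs"
      by (rule not_lyndon_blocksE)
    then have "finite b" "Node l r \<notin> b"
      using finite_blocks[of b l] Union_blocks[of l] Node_notin_internal(1)[of l r] by auto
    with b False Node show ?thesis
      by (auto simp flip: Node.IH)
  qed (use Node in auto)
qed simp

lemma not_lyndon_blocks:
  "x \<in> internal_nodes t \<Longrightarrow> \<not> is_lyndon x \<Longrightarrow> \<exists>B\<in>set (blocks t). x \<in> B \<and> left_child x \<in> B"
proof (induction t)
  case (Node l r)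
  show ?case
  proof (cases "is_lyndon (Node l r)")
    case True
    with Node show ?thesis by auto
  next
    case False
    then obtain b bs where b: "blocks l = b # bs" "l \<in> b"
      by (rule not_lyndon_blocksE)
    consider "x = Node l r" | "x \<in> internal_nodes l" | "x \<in> internal_nodes r"
      using Node.prems(1) by auto
    then show ?thesis
      using Node False b by cases auto
  qed
qed simp

text \<open>The lists give the finest partition: at a non-Lyndon root, the member of
  \<open>Q\<close> containing the root and the one containing the block of \<open>l\<close> share
  \<open>l\<close>, hence coincide.\<close>

lemma blocks_minimal:
  assumes "disjoint Q" "internal_nodes t \<subseteq> \<Union> Q" "b \<in> set (blocks t)"
    "\<And>x. x \<in> internal_nodes t \<Longrightarrow> \<not> is_lyndon x \<Longrightarrow> \<exists>B\<in>Q. x \<in> B \<and> left_child x \<in> B"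
  shows "\<exists>B\<in>Q. b \<subseteq> B"
  using assms(2-)
proof (induction t arbitrary: b)
  case (Node l r)
  have IHl: "\<exists>B\<in>Q. b \<subseteq> B" if "b \<in> set (blocks l)" for b
    using Node that by auto
  have IHr: "\<exists>B\<in>Q. b \<subseteq> B" if "b \<in> set (blocks r)" for b
    using Node that by auto
  show ?case
  proof (cases "is_lyndon (Node l r)")
    case True
    then show ?thesis using Node.prems(1,2) IHl IHr by auto
  next
    case False
    then obtain c cs where c: "blocks l = c # cs" "l \<in> c"
      by (rule not_lyndon_blocksE)
    obtain B where B: "B \<in> Q" "Node l r \<in> B" "l \<in> B"
      using Node.prems(3)[of "Node l r"] False by auto
    obtain C where C: "C \<in> Q" "c \<subseteq> C"
      using IHl c by auto
    have "B = C"
      using assms(1) B C c by (auto simp: disjoint_def)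
    then show ?thesis
      using Node.prems(2) IHl IHr c False B C by auto
  qed
qed simp

lemma lyndon_partition_blocks:
  assumes "distinct (leaves t)"
  shows "lyndon_partition t = set (blocks t)"
  unfolding lyndon_partition_def
proof (rule the1_equality[OF lyndon_partition_exists_unique])
  have "a \<inter> b = {}" if "a \<in> set (blocks t)" "b \<in> set (blocks t)" "a \<noteq> b" for a b
  proof -
    obtain i j where "i < length (blocks t)" "j < length (blocks t)" "a = blocks t ! i" "b = blocks t ! j"
      using \<open>a \<in> _\<close> \<open>b \<in> _\<close> by (auto simp: in_set_conv_nth)
    with \<open>a \<noteq> b\<close> show ?thesis
      using sorted_wrt_nth_less[OF blocks_disjoint[OF assms], of i j]
        sorted_wrt_nth_less[OF blocks_disjoint[OF assms], of j i]
      by (cases i j rule: linorder_cases) auto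
  qed
  moreover have "{} \<notin> set (blocks t)"
    using blocks_ne by blast
  ultimately have part: "partition_on (internal_nodes t) (set (blocks t))"
    using Union_blocks[of t] by (auto simp: partition_on_def disjoint_def)
  then have "lyndon_compatible t (set (blocks t))"
    using not_lyndon_blocks by (auto simp: lyndon_compatible_def)
  moreover have "refines (internal_nodes t) (set (blocks t)) Q" if "lyndon_compatible t Q" for Q
    using that part blocks_minimal[of Q t]
    by (auto simp: refines_def lyndon_compatible_def partition_on_def)
  ultimately show "lyndon_compatible t (set (blocks t)) \<and>
      (\<forall>Q. lyndon_compatible t Q \<longrightarrow> refines (internal_nodes t) (set (blocks t)) Q)"
    by blast
qed

lemma lyndon_type_sizes:
  assumes "distinct (leaves t)"
  shows "lyndon_type t = mset (sizes t)"
proof -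
  have "distinct (blocks t)"
    unfolding distinct_conv_nth
  proof (intro allI impI notI)
    fix i j
    assume ij: "i < length (blocks t)" "j < length (blocks t)" "i \<noteq> j" "blocks t ! i = blocks t ! j"
    have "blocks t ! i \<inter> blocks t ! j = {}"
      using ij(1-3) sorted_wrt_nth_less[OF blocks_disjoint[OF assms], of i j]
        sorted_wrt_nth_less[OF blocks_disjoint[OF assms], of j i]
      by (cases i j rule: linorder_cases) auto
    with ij(4) blocks_ne[OF nth_mem[OF ij(1)]] show False by simp
  qed
  then show ?thesis
    by (simp add: lyndon_type_def lyndon_partition_blocks[OF assms] mset_set_set flip: map_card_blocks)
qed

section \<open>Colourings of a tree\<close>

primrec shape :: "nat bword \<Rightarrow> ltree" where
  "shape (Gen a) = Leaf a"
| "shape (Br k S U) = Node (shape S) (shape U)"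

text \<open>The value at a leaf is a dummy: a node whose left child is a leaf is Lyndon.\<close>

primrec root_colour :: "nat bword \<Rightarrow> nat" where
  "root_colour (Gen a) = 0"
| "root_colour (Br k S U) = k"

primrec cblocks :: "nat bword \<Rightarrow> nat set list" where
  "cblocks (Gen a) = []"
| "cblocks (Br k S U) = (if is_lyndon (Node (shape S) (shape U)) then {k} # cblocks S
     else insert k (hd (cblocks S)) # tl (cblocks S)) @ cblocks U"

definition indicator_exp :: "nat set \<Rightarrow> (nat \<Rightarrow>\<^sub>0 nat)" where
  "indicator_exp S = (\<Sum>j\<in>S. Poly_Mapping.single j 1)"

lemma indicator_exp_insert:
  "finite S \<Longrightarrow> k \<notin> S \<Longrightarrow> indicator_exp (insert k S) = Poly_Mapping.single k 1 + indicator_exp S"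
  "indicator_exp {} = 0"
  by (simp_all add: indicator_exp_def)

abbreviation has_card :: "nat set \<Rightarrow> nat \<Rightarrow> bool" where
  "has_card S k \<equiv> finite S \<and> card S = k"

lemma set_leaves_shape: "set (leaves (shape T)) = set_bword T"
  by (induction T) auto

lemma valency_shape: "valency (shape T) = min_leaf T"
  by (simp add: valency_def set_leaves_shape min_leaf_eq_Min)

lemma lyndon_Br_iff:
  "lyndon (Br k S U) \<longleftrightarrow> lyndon S \<and> lyndon U \<and> (is_lyndon (Node (shape S) (shape U)) \<or> k < root_colour S)"
  by (cases S) (auto simp: valency_shape)

lemma sizes_pos: "m \<in> set (sizes t) \<Longrightarrow> 0 < m"
proof (induction t arbitrary: m)
  case (Node l r)
  then show ?case
    by (cases "is_lyndon (Node l r)"; cases "sizes l") auto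
qed simp

lemma not_lyndon_sizesE:
  assumes "\<not> is_lyndon (Node l r)"
  obtains m ms where "sizes l = m # ms" "0 < m"
proof -
  obtain l1 l2 where "l = Node l1 l2"
    using not_lyndon_NodeE[OF assms] .
  then have "sizes l \<noteq> []"
    using blocks_Node_ne(2) by blast
  then show ?thesis
    using that sizes_pos[of _ l] by (cases "sizes l") auto
qed

text \<open>The last conjunct drives the induction: a non-Lyndon root has a colour below the minimum
  of the block it joins, so the colour is new and becomes the minimum.\<close>

lemma cblocks_sizes:
  "lyndon T \<Longrightarrow> list_all2 has_card (cblocks T) (sizes (shape T)) \<and>
     wt T = sum_list (map indicator_exp (cblocks T)) \<and>
     (cblocks T \<noteq> [] \<longrightarrow> root_colour T = Min (hd (cblocks T)))"
proof (induction T)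
  case (Br k S U)
  then have S: "list_all2 has_card (cblocks S) (sizes (shape S))"
      "wt S = sum_list (map indicator_exp (cblocks S))"
      "cblocks S \<noteq> [] \<longrightarrow> root_colour S = Min (hd (cblocks S))"
    and U: "list_all2 has_card (cblocks U) (sizes (shape U))"
      "wt U = sum_list (map indicator_exp (cblocks U))"
    by (auto simp: lyndon_Br_iff simp del: lyndon.simps)
  show ?case
  proof (cases "is_lyndon (Node (shape S) (shape U))")
    case True
    then show ?thesis
      using S U by (auto simp: list_all2_appendI indicator_exp_insert ac_simps)
  next
    case False
    then obtain m ms where m: "sizes (shape S) = m # ms" "0 < m"
      by (rule not_lyndon_sizesE)
    with S(1) obtain b bs where b: "cblocks S = b # bs" "has_card b m" "list_all2 has_card bs ms"
      by (auto simp: list_all2_Cons2)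
    have "k < Min b"
      using Br.prems False S(3) b(1) by (simp add: lyndon_Br_iff del: lyndon.simps)
    moreover have "b \<noteq> {}"
      using b m by auto
    ultimately have k: "k \<notin> b" "Min (insert k b) = k"
      using b(2) by (auto intro!: Min_eqI)
    show ?thesis
      using False S U m b k
      by (auto simp: list_all2_appendI indicator_exp_insert ac_simps)
  qed
qed simp

lemma cblocks_inj:
  "lyndon T \<Longrightarrow> lyndon T' \<Longrightarrow> shape T = shape T' \<Longrightarrow> cblocks T = cblocks T' \<Longrightarrow> T = T'"
proof (induction T arbitrary: T')
  case (Gen a)
  then show ?case by (cases T') auto
next
  case (Br k S U)
  from Br.prems(3) obtain k' S' U' where T': "T' = Br k' S' U'" "shape S = shape S'" "shape U = shape U'"
    by (cases T') auto
  have lyndon: "lyndon S" "lyndon U" "lyndon S'" "lyndon U'"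
    using Br.prems T' by (auto simp: lyndon_Br_iff simp del: lyndon.simps)
  \<comment> \<open>Equal lengths allow the concatenated lists to be split at the same
    place.\<close>
  have len: "length (cblocks S) = length (cblocks S')"
    using cblocks_sizes[OF lyndon(1)] cblocks_sizes[OF lyndon(3)] T'(2) by (auto dest!: list_all2_lengthD)
  have "k = k' \<and> cblocks S = cblocks S' \<and> cblocks U = cblocks U'"
  proof (cases "is_lyndon (Node (shape S) (shape U))")
    case True
    then show ?thesis
      using Br.prems(4) T' len by auto
  next
    case False
    then obtain m ms where m: "sizes (shape S) = m # ms" "0 < m"
      by (rule not_lyndon_sizesE)
    obtain b bs where b: "cblocks S = b # bs" "has_card b m"
      using cblocks_sizes[OF lyndon(1)] m by (auto simp: list_all2_Cons2)
    obtain b' bs' where b': "cblocks S' = b' # bs'" "has_card b' m"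
      using cblocks_sizes[OF lyndon(3)] m T'(2) by (auto simp: list_all2_Cons2)
    have less: "k < Min b" "k' < Min b'"
      using Br.prems(1,2) False T' b b' cblocks_sizes[OF lyndon(1)] cblocks_sizes[OF lyndon(3)]
      by (auto simp: lyndon_Br_iff simp del: lyndon.simps)
    have ne: "b \<noteq> {}" "b' \<noteq> {}"
      using b b' m by auto
    have eq: "insert k b = insert k' b'" "bs @ cblocks U = bs' @ cblocks U'"
      using Br.prems(4) T' False b b' by auto
    have k: "Min (insert k b) = k" "k \<notin> b" "Min (insert k' b') = k'" "k' \<notin> b'"
      using less ne b b' by (auto intro!: Min_eqI)
    then have "k = k'" using eq(1) by simp
    moreover have "b = b'"
      using eq(1) k \<open>k = k'\<close> by (metis insert_ident)
    ultimately show ?thesis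
      using eq(2) len b b' by auto
  qed
  then show ?case
    using Br.IH lyndon T' by blast
qed

text \<open>In the non-Lyndon case the root takes the smallest colour of its block and leaves the
  others to the left child.\<close>

lemma cblocks_surj:
  "list_all2 has_card Ss (sizes t) \<Longrightarrow> \<exists>T. shape T = t \<and> lyndon T \<and> cblocks T = Ss"
proof (induction t arbitrary: Ss)
  case (Leaf a)
  then show ?case by (intro exI[of _ "Gen a"]) simp
next
  case (Node l r)
  show ?case
  proof (cases "is_lyndon (Node l r)")
    case True
    with Node.prems obtain S0 Ss1 Ss2 where Ss: "Ss = S0 # Ss1 @ Ss2" "has_card S0 1"
      "list_all2 has_card Ss1 (sizes l)" "list_all2 has_card Ss2 (sizes r)"
      by (auto simp: list_all2_Cons2 list_all2_append2)
    obtain k where k: "S0 = {k}"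
      using Ss(2) by (auto simp: card_1_singleton_iff)
    obtain T1 T2 where "shape T1 = l" "lyndon T1" "cblocks T1 = Ss1" "shape T2 = r" "lyndon T2" "cblocks T2 = Ss2"
      using Node.IH Ss by meson
    then show ?thesis
      using True Ss k by (intro exI[of _ "Br k T1 T2"]) (simp add: lyndon_Br_iff del: lyndon.simps)
  next
    case False
    then obtain m ms where m: "sizes l = m # ms" "0 < m"
      by (rule not_lyndon_sizesE)
    with Node.prems False obtain S0 Ss1 Ss2 where Ss: "Ss = S0 # Ss1 @ Ss2" "has_card S0 (Suc m)"
      "list_all2 has_card Ss1 ms" "list_all2 has_card Ss2 (sizes r)"
      by (auto simp: list_all2_Cons2 list_all2_append2)
    let ?k = "Min S0"
    have "S0 \<noteq> {}"
      using Ss(2) by auto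
    then have S0: "S0 \<noteq> {}" "?k \<in> S0"
      using Ss(2) Min_in by auto
    then have card: "has_card (S0 - {?k}) m"
      using Ss(2) by simp
    then have ne: "S0 - {?k} \<noteq> {}"
      using m(2) by (metis card.empty less_irrefl)
    obtain T1 where T1: "shape T1 = l" "lyndon T1" "cblocks T1 = (S0 - {?k}) # Ss1"
      using Node.IH(1)[of "(S0 - {?k}) # Ss1"] card m Ss by auto
    obtain T2 where T2: "shape T2 = r" "lyndon T2" "cblocks T2 = Ss2"
      using Node.IH(2) Ss by meson
    have "root_colour T1 = Min (S0 - {?k})"
      using cblocks_sizes[OF T1(2)] T1(3) by simp
    moreover have "Min (S0 - {?k}) \<in> S0 - {?k}"
      using card ne by (intro Min_in) auto
    ultimately have "?k < root_colour T1"
      using Ss(2) by (metis DiffD1 DiffD2 Min_le insertI1 order_le_less)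
    moreover have "insert ?k (S0 - {?k}) = S0"
      using S0(2) by blast
    ultimately show ?thesis
      using False Ss T1 T2 by (intro exI[of _ "Br ?k T1 T2"]) (simp add: lyndon_Br_iff del: lyndon.simps)
  qed
qed

definition colourings :: "ltree \<Rightarrow> (nat \<Rightarrow>\<^sub>0 nat) \<Rightarrow> nat bword set" where
  "colourings t \<mu> = {T. shape T = t \<and> lyndon T \<and> wt T = \<mu>}"

definition set_lists :: "nat list \<Rightarrow> (nat \<Rightarrow>\<^sub>0 nat) \<Rightarrow> nat set list set" where
  "set_lists ks \<mu> = {Ss. list_all2 has_card Ss ks \<and> sum_list (map indicator_exp Ss) = \<mu>}"

lemma bij_betw_cblocks: "bij_betw cblocks (colourings t \<mu>) (set_lists (sizes t) \<mu>)"
  unfolding bij_betw_def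
proof
  show "inj_on cblocks (colourings t \<mu>)"
    by (auto simp: inj_on_def colourings_def intro: cblocks_inj)
  show "cblocks ` colourings t \<mu> = set_lists (sizes t) \<mu>"
    using cblocks_surj[of _ t] cblocks_sizes by (fastforce simp: colourings_def set_lists_def image_iff)
qed

section \<open>Coefficients of products of elementary symmetric functions\<close>

lemma lookup_indicator_exp:
  "finite S \<Longrightarrow> Poly_Mapping.lookup (indicator_exp S) j = (if j \<in> S then 1 else 0)"
  by (simp add: indicator_exp_def lookup_sum lookup_single when_def)

text \<open>A finite set is the support of its own exponent vector, so at most one set is
  counted.\<close>

lemma elem_sym_coeff:
  "finite {S. has_card S k \<and> indicator_exp S = a} \<and>
   mvps_coeff (elem_sym k) a = int (card {S. has_card S k \<and> indicator_exp S = a})"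
proof -
  have keys: "S = Poly_Mapping.keys a" "\<forall>j. Poly_Mapping.lookup a j \<le> 1" if "finite S" "indicator_exp S = a" for S
    using that lookup_indicator_exp[of S] by (auto simp: in_keys_iff split: if_splits)
  have one: "Poly_Mapping.lookup a j = 1" if "\<forall>j. Poly_Mapping.lookup a j \<le> 1" "j \<in> Poly_Mapping.keys a" for j
    using that(1)[rule_format, of j] that(2) by (auto simp: in_keys_iff le_Suc_eq)
  have sum: "(\<Sum>j\<in>Poly_Mapping.keys a. Poly_Mapping.lookup a j) = card (Poly_Mapping.keys a)"
    if "\<forall>j. Poly_Mapping.lookup a j \<le> 1"
    using one[OF that] by simp
  show ?thesis
  proof (cases "a \<in> WComp k \<and> (\<forall>j. Poly_Mapping.lookup a j \<le> 1)")
    case True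
    then have "card (Poly_Mapping.keys a) = k"
      using sum by (simp add: WComp_def)
    moreover have "indicator_exp (Poly_Mapping.keys a) = a"
      using True one by (auto intro!: poly_mapping_eqI simp: lookup_indicator_exp in_keys_iff)
    ultimately have "{S. has_card S k \<and> indicator_exp S = a} = {Poly_Mapping.keys a}"
      using keys(1) finite_keys[of a] by blast
    with True show ?thesis
      by (simp add: elem_sym_def formal_sum_def)
  next
    case False
    have "\<not> (has_card S k \<and> indicator_exp S = a)" for S
    proof
      assume S: "has_card S k \<and> indicator_exp S = a"
      then have le: "\<forall>j. Poly_Mapping.lookup a j \<le> 1" and eq: "S = Poly_Mapping.keys a"
        using keys by blast+
      have "a \<in> WComp k"
        unfolding WComp_def mem_Collect_eq sum[OF le] using S eq by argo
      with le False show False by blast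
    qed
    then have empty: "{S. has_card S k \<and> indicator_exp S = a} = {}"
      by blast
    show ?thesis
      unfolding empty using False by (auto simp: elem_sym_def formal_sum_def)
  qed
qed

lemma set_lists_Cons:
  "set_lists (k # ks) \<mu> = (\<Union>(a, b)\<in>splits \<mu>.
     (\<lambda>(S, Ss). S # Ss) ` ({S. has_card S k \<and> indicator_exp S = a} \<times> set_lists ks b))"
  by (auto simp: set_lists_def splits_def list_all2_Cons2 image_iff)

lemma prod_elem_sym_coeff:
  "finite (set_lists ks \<mu>) \<and> mvps_coeff (prod_list (map elem_sym ks)) \<mu> = int (card (set_lists ks \<mu>))"
proof (induction ks arbitrary: \<mu>)
  case Nil
  have "set_lists [] \<mu> = (if \<mu> = 0 then {[]} else {})"
    by (auto simp: set_lists_def)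
  then show ?case by (simp add: one_mvps_def)
next
  case (Cons k ks)
  let ?A = "\<lambda>a. {S. has_card S k \<and> indicator_exp S = a}"
  let ?C = "\<lambda>(a, b). (\<lambda>(S, Ss). S # Ss) ` (?A a \<times> set_lists ks b)"
  have fin: "finite (?C p)" for p
    using elem_sym_coeff[of k] Cons.IH by (auto simp: case_prod_unfold)
  have card: "card (?C (a, b)) = card (?A a) * card (set_lists ks b)" for a b
    by (simp add: card_image inj_on_def card_cartesian_product)
  have "card (set_lists (k # ks) \<mu>) = (\<Sum>p\<in>splits \<mu>. card (?C p))"
    unfolding set_lists_Cons using fin
    by (intro card_UN_disjoint) (auto simp: set_lists_def)
  also have "int \<dots> = (\<Sum>(a, b)\<in>splits \<mu>. int (card (?A a)) * int (card (set_lists ks b)))"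
    unfolding of_nat_sum by (intro sum.cong refl) (simp only: case_prod_beta card[symmetric] of_nat_mult[symmetric] prod.collapse)
  also have "\<dots> = mvps_coeff (prod_list (map elem_sym (k # ks))) \<mu>"
    using elem_sym_coeff[of k] Cons.IH by (simp add: times_mvps_def)
  finally show ?case
    unfolding set_lists_Cons using fin by (simp add: case_prod_unfold)
qed

lemma mvps_coeff_sum: "mvps_coeff (sum f A) \<mu> = (\<Sum>a\<in>A. mvps_coeff (f a) \<mu>)"
  by (induction A rule: infinite_finite_induct) (simp_all add: zero_mvps_def plus_mvps_def)

lemma colourings_coeff:
  assumes "distinct (leaves t)"
  shows "finite (colourings t \<mu>)"
    and "mvps_coeff (elem_sym_partition (lyndon_type t)) \<mu> = int (card (colourings t \<mu>))"
proof -
  have "elem_sym_partition (lyndon_type t) = prod_list (map elem_sym (sizes t))"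
    by (simp add: elem_sym_partition_def lyndon_type_sizes[OF assms] flip: mset_map prod_mset_prod_list)
  then show "mvps_coeff (elem_sym_partition (lyndon_type t)) \<mu> = int (card (colourings t \<mu>))"
    using prod_elem_sym_coeff[of "sizes t" \<mu>] bij_betw_same_card[OF bij_betw_cblocks[of t \<mu>]] by simp
  show "finite (colourings t \<mu>)"
    using prod_elem_sym_coeff[of "sizes t" \<mu>] bij_betw_finite[OF bij_betw_cblocks[of t \<mu>]] by blast
qed

text \<open>Equal valencies of a node and its left child give only a weak inequality of smallest
  leaves; disjoint leaf sets make it strict.\<close>

lemma normal_iff_shape:
  "normal T \<longleftrightarrow> distinct (leaves (shape T)) \<and>
    (\<forall>x\<in>internal_nodes (shape T). valency x = valency (left_child x))"
proof (induction T)
  case (Br k S U)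
  have "valency (Node (shape S) (shape U)) = min (min_leaf S) (min_leaf U)"
    using valency_shape[of "Br k S U"] by simp
  then have val: "valency (Node (shape S) (shape U)) = valency (left_child (Node (shape S) (shape U))) \<longleftrightarrow> min_leaf S \<le> min_leaf U"
    by (simp add: valency_shape min_def)
  have less: "min_leaf S \<le> min_leaf U \<longleftrightarrow> min_leaf S < min_leaf U" if "set_bword S \<inter> set_bword U = {}"
    using min_leaf_neq[OF that] by linarith
  show ?case
    unfolding normal.simps shape.simps leaves.simps distinct_append set_leaves_shape
      internal_nodes.simps ball_simps(7) ball_Un val Br
    using less by blast
qed simp

lemma lyndon_trees_colourings: "lyndon_trees {1..n} \<mu> = (\<Union>t\<in>Nor n. colourings t \<mu>)"
  by (auto simp: lyndon_trees_def colourings_def Nor_def normal_iff_shape set_leaves_shape)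

lemma wt_WComp:
  assumes "normal T"
  shows "wt T \<in> WComp (card (set_bword T) - 1)"
proof -
  have plus: "(\<Sum>j\<in>Poly_Mapping.keys (p + q). Poly_Mapping.lookup (p + q) j) =
      (\<Sum>j\<in>Poly_Mapping.keys p. Poly_Mapping.lookup p j) + (\<Sum>j\<in>Poly_Mapping.keys q. Poly_Mapping.lookup q j)"
    for p q :: "nat \<Rightarrow>\<^sub>0 nat"
    by (rule setsum_keys_plus_distrib) auto
  \<comment> \<open>A binary tree has one leaf more than it has internal nodes; the
    \<open>Suc\<close> form avoids truncated subtraction in the induction.\<close>
  have "Suc (\<Sum>j\<in>Poly_Mapping.keys (wt T). Poly_Mapping.lookup (wt T) j) = card (set_bword T)"
    using assms by (induction T) (auto simp: plus card_Un_disjoint)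
  then show ?thesis
    by (simp add: WComp_def)
qed

theorem theorem4p3:
  fixes n :: nat
  assumes "n \<ge> 1"
  shows "formal_sum (WComp (n - 1))
           (\<lambda>\<mu>. int (free_lie.dim (Lie n \<mu> :: (nat, 'k::field) free_lie set))) =
         (\<Sum>\<Upsilon>\<in>Nor n. elem_sym_partition (lyndon_type \<Upsilon>))"
proof (rule mvps_eqI)
  fix \<mu>
  have distinct: "distinct (leaves t)" if "t \<in> Nor n" for t
    using that by (simp add: Nor_def)
  \<comment> \<open>Outside \<open>WComp (n - 1)\<close> there are no Lyndon trees, in agreement
    with the coefficient 0 of the formal sum.\<close>
  have "\<mu> \<in> WComp (n - 1)" if "T \<in> lyndon_trees {1..n} \<mu>" for T
    using that wt_WComp[of T] by (simp add: lyndon_trees_def)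
  then have "lyndon_trees {1..n} \<mu> = {}" if "\<mu> \<notin> WComp (n - 1)"
    using that by blast
  then have "mvps_coeff (formal_sum (WComp (n - 1))
      (\<lambda>\<mu>. int (free_lie.dim (Lie n \<mu> :: (nat, 'k) free_lie set)))) \<mu> = int (card (lyndon_trees {1..n} \<mu>))"
    by (auto simp: formal_sum_def dim_Lie simp del: One_nat_def)
  also have "card (lyndon_trees {1..n} \<mu>) = (\<Sum>t\<in>Nor n. card (colourings t \<mu>))"
    unfolding lyndon_trees_colourings
  proof (rule card_UN_disjoint)
    show "\<forall>t\<in>Nor n. finite (colourings t \<mu>)"
      by (simp add: colourings_coeff(1) distinct)
  qed (auto simp: finite_Nor colourings_def)
  also have "int \<dots> = mvps_coeff (\<Sum>\<Upsilon>\<in>Nor n. elem_sym_partition (lyndon_type \<Upsilon>)) \<mu>"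
    by (simp add: mvps_coeff_sum colourings_coeff(2) distinct)
  finally show "mvps_coeff (formal_sum (WComp (n - 1))
      (\<lambda>\<mu>. int (free_lie.dim (Lie n \<mu> :: (nat, 'k) free_lie set)))) \<mu> =
    mvps_coeff (\<Sum>\<Upsilon>\<in>Nor n. elem_sym_partition (lyndon_type \<Upsilon>)) \<mu>" .
qed

end
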